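(* Let $(X_k^\diamond,U_k^\diamond)_{k\ge0}$ be the trajectory of $X_{k+1}=AX_k+BU_k+EW_k$, $X_0=X_{\mathrm{ini}}$, under $U_k^\diamond=KX_k^\diamond+F\,\mathbb E[W]$ (the overtakingly optimal trajectory of the stochastic infinite-horizon LQ problem). Then the laws $(\mu_{X_k^\diamond},\mu_{U_k^\diamond})$ converge as $k\to\infty$ to $(\mu_X^\diamond,\mu_U^\diamond)$, where $\mu_X^\diamond$ is the law of $$(I-\tilde A)^{-1}\tilde F\,\mathbb E[W]+\sum_{j=0}^\infty\tilde A^jE(W_j-\mathbb E[W])$$ and $\mu_U^\diamond$ is the law of $$\big(K(I-\tilde A)^{-1}\tilde F+F\big)\mathbb E[W]+K\sum_{j=0}^\infty\tilde A^jE(W_j-\mathbb E[W]).$$ The first two moments of $\mu_X^\diamond$ are $\mathbb E[\mu_X^\diamond]=(I-\tilde A)^{-1}\tilde F\,\mathbb E[W]$ and $\Sigma[\mu_X^\diamond]=\sum_{j=0}^\infty\tilde A^jE\Sigma[W]E^\top\tilde A^{j\top}$. Moreover, any $(X,U)$ with $X\sim\mu_X^\diamond$ and $U=KX+F\,\mathbb E[W]$ is a stationary pair of the system.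
   Context: $A\in\mathbb R^{n_x\times n_x}$, $B\in\mathbb R^{n_x\times n_u}$, $E\in\mathbb R^{n_x\times n_w}$; $Q\succeq0$, $R\succ0$; $(A,B)$ stabilizable, $(A,Q^{1/2})$ detectable. $X_{\mathrm{ini}}$ is a square-integrable random vector and $W_0,W_1,\dots$ are i.i.d. square-integrable random vectors, independent of $X_{\mathrm{ini}}$, each distributed as $W$; $\Sigma[\cdot]$ denotes covariance. Stationary quantities: $P$ is the stabilizing symmetric positive semidefinite solution of $P=Q+A^\top(P-PB(R+B^\top PB)^{-1}B^\top P)A$; $K=-(R+B^\top PB)^{-1}B^\top PA$; $\tilde A=A+BK$ (Schur stable); $G$ is the unique solution of $G=\tilde A^\top(PE+G)$; $F=-(R+B^\top PB)^{-1}B^\top(PE+G)$; $\tilde F=BF+E$. The law of a random vector $Z$ is $\mu_Z$, and moments of a law are those of any random vector with that law. Stationary pair: square-integrable $(\bar X,\bar U)$ such that $\bar X$ and $A\bar X+B\bar U+EW'$ have the same distribution, where $W'$ has the law of $W$ and is independent of $(\bar X,\bar U)$. *)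

theory Defs
  imports "HOL-Analysis.Analysis" "HOL-Probability.Probability"
begin

section \<open>Matrices\<close>

text \<open>Matrix power (note: the operator ^ on vec types is componentwise, so we use matrix product).\<close>
fun matpow :: "real^'n^'n \<Rightarrow> nat \<Rightarrow> real^'n^'n" where
  "matpow A 0 = mat 1"
| "matpow A (Suc k) = A ** matpow A k"

definition sym_mat :: "real^'n^'n \<Rightarrow> bool" where
  "sym_mat Q \<longleftrightarrow> transpose Q = Q"

definition psd :: "real^'n^'n \<Rightarrow> bool" where
  "psd Q \<longleftrightarrow> sym_mat Q \<and> (\<forall>x. 0 \<le> x \<bullet> (Q *v x))"

definition pd :: "real^'n^'n \<Rightarrow> bool" where
  "pd Q \<longleftrightarrow> sym_mat Q \<and> (\<forall>x. x \<noteq> 0 \<longrightarrow> 0 < x \<bullet> (Q *v x))"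

text \<open>Principal (PSD) square root of a PSD matrix.\<close>
definition msqrt :: "real^'n^'n \<Rightarrow> real^'n^'n" where
  "msqrt Q = (THE S. psd S \<and> S ** S = Q)"

definition cmat :: "real^'n^'m \<Rightarrow> complex^'n^'m" where
  "cmat A = (\<chi> i j. complex_of_real (A $ i $ j))"

text \<open>Schur stability: every (complex) eigenvalue has modulus < 1.\<close>
definition schur_stable :: "real^'n^'n \<Rightarrow> bool" where
  "schur_stable A \<longleftrightarrow>
     (\<forall>(c::complex) (v::complex^'n). v \<noteq> 0 \<and> cmat A *v v = (\<chi> i. c * v $ i) \<longrightarrow> cmod c < 1)"

definition stabilizable :: "real^'n^'n \<Rightarrow> real^'m^'n \<Rightarrow> bool" where
  "stabilizable A B \<longleftrightarrow> (\<exists>L :: real^'n^'m. schur_stable (A + B ** L))"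

definition detectable :: "real^'n^'n \<Rightarrow> real^'n^'p \<Rightarrow> bool" where
  "detectable A C \<longleftrightarrow> (\<exists>L :: real^'p^'n. schur_stable (A + L ** C))"

section \<open>Laws\<close>

text \<open>Mean and covariance matrix of a law on R^n.\<close>
definition mean_law :: "(real^'n) measure \<Rightarrow> real^'n" where
  "mean_law \<mu> = (\<integral>x. x \<partial>\<mu>)"

definition cov_law :: "(real^'n) measure \<Rightarrow> real^'n^'n" where
  "cov_law \<mu> = (\<chi> i j. \<integral>x. (x $ i - mean_law \<mu> $ i) * (x $ j - mean_law \<mu> $ j) \<partial>\<mu>)"

text \<open>Weak convergence of probability laws on a metric space.\<close>
definition weak_conv_law :: "(nat \<Rightarrow> 'b::metric_space measure) \<Rightarrow> 'b measure \<Rightarrow> bool" where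
  "weak_conv_law \<mu>s \<mu> \<longleftrightarrow>
     (\<forall>f :: 'b \<Rightarrow> real. continuous_on UNIV f \<and> bounded (range f) \<longrightarrow>
        (\<lambda>k. \<integral>x. f x \<partial>\<mu>s k) \<longlonglongrightarrow> (\<integral>x. f x \<partial>\<mu>))"

text \<open>Couplings and squared 2-Wasserstein distance.\<close>
definition couplings :: "'b::{metric_space,second_countable_topology} measure \<Rightarrow> 'b measure \<Rightarrow> ('b \<times> 'b) measure set" where
  "couplings \<mu> \<nu> = {\<pi>. prob_space \<pi> \<and> sets \<pi> = sets (borel \<Otimes>\<^sub>M borel) \<and>
       distr \<pi> borel fst = \<mu> \<and> distr \<pi> borel snd = \<nu>}"

definition wasserstein2_sq :: "'b::{metric_space,second_countable_topology} measure \<Rightarrow> 'b measure \<Rightarrow> ennreal" where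
  "wasserstein2_sq \<mu> \<nu> = (INF \<pi>\<in>couplings \<mu> \<nu>. \<integral>\<^sup>+ p. ennreal ((dist (fst p) (snd p))\<^sup>2) \<partial>\<pi>)"

definition W2_conv_law :: "(nat \<Rightarrow> 'b::{metric_space,second_countable_topology} measure) \<Rightarrow> 'b measure \<Rightarrow> bool" where
  "W2_conv_law \<mu>s \<mu> \<longleftrightarrow> (\<lambda>k. wasserstein2_sq (\<mu>s k) \<mu>) \<longlonglongrightarrow> 0"

section \<open>Stationary pairs\<close>

text \<open>A square-integrable pair (Xb,Ub) on a probability space N is stationary if Xb has the same
  law as A Xb + B Ub + E W', where W' has law muW and is independent of (Xb,Ub); the independent
  copy W' is realised as the second coordinate of the product space N x muW.\<close>
definition stationary_pair ::
  "real^'nx^'nx \<Rightarrow> real^'nu^'nx \<Rightarrow> real^'nw^'nx \<Rightarrow> (real^'nw) measure \<Rightarrow>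
   'b measure \<Rightarrow> ('b \<Rightarrow> real^'nx) \<Rightarrow> ('b \<Rightarrow> real^'nu) \<Rightarrow> bool" where
  "stationary_pair A B E \<mu>W N Xb Ub \<longleftrightarrow>
     Xb \<in> borel_measurable N \<and> Ub \<in> borel_measurable N \<and>
     integrable N (\<lambda>\<omega>. (norm (Xb \<omega>))\<^sup>2) \<and> integrable N (\<lambda>\<omega>. (norm (Ub \<omega>))\<^sup>2) \<and>
     distr N borel Xb =
       distr (N \<Otimes>\<^sub>M \<mu>W) borel (\<lambda>(\<omega>, w). A *v Xb \<omega> + B *v Ub \<omega> + E *v w)"

end

(* Under the feedback the state obeys X (k+1) = At X k + Ft m + E (W k - m), with m the noise
   mean, so X k = At^k X 0 + sum_{i<k} At^i (Ft m + E (W (k-1-i) - m)). Reversing the order of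
   the first k i.i.d. noise values does not change the law of the noise path, and turns this
   into a partial sum of the series defining the limit state. Schur stability of At gives
   geometric decay of its powers, so on the product of the initial law and the path law these
   partial sums converge almost surely and in mean square; the first yields weak convergence of
   the laws, the second bounds their Wasserstein distance (via the obvious coupling), and
   Lipschitz images carry both to the inputs. The series has centred, independent terms, which
   gives the mean and the covariance. Stationarity holds because feeding the limit state one more
   independent noise value amounts to shifting the noise path, which preserves its law. *)

theory Submission imports Defs "Jordan_Normal_Form.Spectral_Radius" begin

no_notation Matrix.vec_index (infixl "$" 100)
hide_const (open) Matrix.mat Matrix.vec

text \<open>The spectral-radius bounds of Jordan_Normal_Form are stated for its own matrix type,
  so type-indexed matrices are transported along an enumeration of the index type.\<close>

definition jnf_mat :: "(nat \<Rightarrow> 'n) \<Rightarrow> complex^'n^'n \<Rightarrow> complex Matrix.mat" where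
  "jnf_mat f X = Matrix.mat CARD('n) CARD('n) (\<lambda>(i, j). X $ f i $ f j)"

lemma jnf_mat_carrier: "jnf_mat f (X::complex^'n^'n) \<in> carrier_mat CARD('n) CARD('n)"
  by (simp add: jnf_mat_def)

lemma jnf_mat_mult:
  fixes X Y :: "complex^'n^'n"
  assumes f: "bij_betw f {..<CARD('n)} (UNIV::'n set)"
  shows "jnf_mat f (X ** Y) = jnf_mat f X * jnf_mat f Y"
proof (rule eq_matI)
  fix i j assume i: "i < dim_row (jnf_mat f X * jnf_mat f Y)" and j: "j < dim_col (jnf_mat f X * jnf_mat f Y)"
  have "(jnf_mat f X * jnf_mat f Y) $$ (i, j) = (\<Sum>k\<in>{0..<CARD('n)}. X $ f i $ f k * Y $ f k $ f j)"
    using i j by (simp add: jnf_mat_def scalar_prod_def)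
  also have "\<dots> = (\<Sum>k\<in>UNIV. X $ f i $ k * Y $ k $ f j)"
    using sum.reindex_bij_betw[OF f, of "\<lambda>k. X $ f i $ k * Y $ k $ f j"]
    by (simp add: atLeast0LessThan)
  finally show "jnf_mat f (X ** Y) $$ (i, j) = (jnf_mat f X * jnf_mat f Y) $$ (i, j)"
    using i j by (simp add: jnf_mat_def matrix_matrix_mult_def)
qed (auto simp: jnf_mat_def)

lemma jnf_mat_one:
  assumes f: "bij_betw f {..<CARD('n)} (UNIV::'n set)"
  shows "jnf_mat f (mat 1 :: complex^'n^'n) = 1\<^sub>m CARD('n)"
proof (rule eq_matI)
  fix i j
  assume i: "i < dim_row (1\<^sub>m CARD('n) :: complex Matrix.mat)"
    and j: "j < dim_col (1\<^sub>m CARD('n) :: complex Matrix.mat)"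
  have "f i = f j \<longleftrightarrow> i = j" using i j f by (auto simp: bij_betw_def inj_on_def)
  then show "jnf_mat f (mat 1) $$ (i, j) = 1\<^sub>m CARD('n) $$ (i, j)"
    using i j by (simp add: jnf_mat_def Finite_Cartesian_Product.mat_def)
qed (auto simp: jnf_mat_def)

lemma jnf_mat_eigenvector:
  fixes X :: "complex^'n^'n"
  assumes f: "bij_betw f {..<CARD('n)} (UNIV::'n set)"
    and ev: "eigenvector (jnf_mat f X) v \<mu>"
  shows "\<exists>u. u \<noteq> 0 \<and> X *v u = (\<chi> i. \<mu> * u $ i)"
proof -
  define n where "n = CARD('n)"
  define g where "g = inv_into {..<n} f"
  have fg: "f (g i) = i" for i using f unfolding g_def n_def
    by (meson UNIV_I bij_betw_inv_into_right)
  have gf: "k < n \<Longrightarrow> g (f k) = k" for k using f unfolding g_def n_def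
    by (meson bij_betw_inv_into_left lessThan_iff)
  have gn: "g i < n" for i using f unfolding g_def n_def
    by (meson UNIV_I bij_betwE bij_betw_inv_into lessThan_iff)
  from ev have vc: "v \<in> carrier_vec n" and v0: "v \<noteq> 0\<^sub>v n" and eq: "jnf_mat f X *\<^sub>v v = \<mu> \<cdot>\<^sub>v v"
    unfolding eigenvector_def by (auto simp: jnf_mat_def n_def)
  define u where "u = (\<chi> i. Matrix.vec_index v (g i))"
  have "X *v u = (\<chi> i. \<mu> * u $ i)"
  proof (subst Finite_Cartesian_Product.vec_eq_iff, intro allI)
    fix i
    have "(X *v u) $ i = (\<Sum>j\<in>UNIV. X $ i $ j * Matrix.vec_index v (g j))"
      by (simp add: matrix_vector_mult_def u_def)
    also have "\<dots> = (\<Sum>k\<in>{..<n}. X $ i $ f k * Matrix.vec_index v (g (f k)))"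
      using sum.reindex_bij_betw[OF f, of "\<lambda>j. X $ i $ j * Matrix.vec_index v (g j)"]
      by (simp add: n_def)
    also have "\<dots> = (\<Sum>k\<in>{..<n}. X $ i $ f k * Matrix.vec_index v k)"
      by (rule sum.cong) (auto simp: gf)
    also have "\<dots> = Matrix.vec_index (jnf_mat f X *\<^sub>v v) (g i)"
      using gn[of i] vc by (simp add: jnf_mat_def n_def scalar_prod_def fg atLeast0LessThan)
    also have "\<dots> = \<mu> * u $ i"
      using eq gn[of i] vc by (simp add: u_def)
    finally show "(X *v u) $ i = (\<chi> i. \<mu> * u $ i) $ i" by simp
  qed
  moreover have "u \<noteq> 0"
  proof
    assume u0: "u = 0"
    have "v = 0\<^sub>v n"
    proof (rule eq_vecI)
      fix k assume "k < dim_vec (0\<^sub>v n :: complex Matrix.vec)"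
      then have k: "k < n" by simp
      have "Matrix.vec_index v k = u $ f k" by (simp add: u_def gf[OF k])
      then show "Matrix.vec_index v k = Matrix.vec_index (0\<^sub>v n) k" using u0 k by simp
    qed (use vc in simp)
    with v0 show False by simp
  qed
  ultimately show ?thesis by blast
qed

lemma matpow_Suc_right: "matpow X (Suc k) = matpow X k ** X"
  by (induction k) (simp_all add: matrix_mul_assoc)

lemma matpow_scaleR: "matpow (c *\<^sub>R X) k = c ^ k *\<^sub>R matpow X k"
  by (induction k) (simp_all add: matrix_scalar_ac scalar_matrix_assoc[symmetric])

lemma cmat_mult: "cmat ((X::real^'n^'m) ** (Y::real^'k^'n)) = cmat X ** cmat Y"
  by (simp add: cmat_def matrix_matrix_mult_def Finite_Cartesian_Product.vec_eq_iff)

lemma cmat_one: "cmat (mat 1 :: real^'n^'n) = mat 1"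
  by (simp add: cmat_def Finite_Cartesian_Product.mat_def Finite_Cartesian_Product.vec_eq_iff)

lemma jnf_mat_matpow:
  fixes X :: "real^'n^'n"
  assumes f: "bij_betw f {..<CARD('n)} (UNIV::'n set)"
  shows "jnf_mat f (cmat (matpow X k)) = jnf_mat f (cmat X) ^\<^sub>m k"
proof (induction k)
  case 0
  show ?case by (simp add: cmat_one jnf_mat_one[OF f]) (simp add: jnf_mat_def)
next
  case (Suc k)
  show ?case by (simp only: matpow_Suc_right cmat_mult jnf_mat_mult[OF f] Suc pow_mat.simps)
qed

lemma spectral_radius_jnf_mat_less_1:
  fixes X :: "real^'n^'n"
  assumes f: "bij_betw f {..<CARD('n)} (UNIV::'n set)" and X: "schur_stable X"
  shows "spectral_radius (jnf_mat f (cmat X)) < 1"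
proof -
  obtain \<mu> where \<mu>: "\<mu> \<in> spectrum (jnf_mat f (cmat X))"
    and \<rho>: "spectral_radius (jnf_mat f (cmat X)) = norm \<mu>"
    using spectral_radius_mem_max(1)[OF jnf_mat_carrier] by fastforce
  from \<mu> obtain v where "eigenvector (jnf_mat f (cmat X)) v \<mu>"
    unfolding spectrum_def eigenvalue_def by auto
  from jnf_mat_eigenvector[OF f this] X have "cmod \<mu> < 1"
    unfolding schur_stable_def by blast
  with \<rho> show ?thesis by simp
qed

lemma spectral_radius_jnf_mat_scaleR_le:
  fixes X :: "real^'n^'n"
  assumes c: "0 < c"
  shows "spectral_radius (jnf_mat f (cmat (c *\<^sub>R X))) \<le> c * spectral_radius (jnf_mat f (cmat X))"
proof -
  define n where "n = CARD('n)"
  have A0c: "jnf_mat f (cmat X) \<in> carrier_mat n n" and A1c: "jnf_mat f (cmat (c *\<^sub>R X)) \<in> carrier_mat n n"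
    by (simp_all add: jnf_mat_carrier n_def)
  obtain \<nu> where \<nu>: "\<nu> \<in> spectrum (jnf_mat f (cmat (c *\<^sub>R X)))"
    and \<nu>n: "spectral_radius (jnf_mat f (cmat (c *\<^sub>R X))) = norm \<nu>"
    using spectral_radius_mem_max(1)[OF A1c] by (auto simp: n_def)
  from \<nu> obtain v where "eigenvector (jnf_mat f (cmat (c *\<^sub>R X))) v \<nu>"
    unfolding spectrum_def eigenvalue_def by auto
  then have vc: "v \<in> carrier_vec n" and v0: "v \<noteq> 0\<^sub>v n"
    and eq: "jnf_mat f (cmat (c *\<^sub>R X)) *\<^sub>v v = \<nu> \<cdot>\<^sub>v v"
    unfolding eigenvector_def using A1c by auto
  have "jnf_mat f (cmat X) *\<^sub>v v = (\<nu> / of_real c) \<cdot>\<^sub>v v"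
  proof (rule eq_vecI)
    fix i assume "i < dim_vec ((\<nu> / of_real c) \<cdot>\<^sub>v v)"
    then have i: "i < n" using vc by simp
    have "of_real c * Matrix.vec_index (jnf_mat f (cmat X) *\<^sub>v v) i
        = Matrix.vec_index (jnf_mat f (cmat (c *\<^sub>R X)) *\<^sub>v v) i"
      using i vc by (simp add: jnf_mat_def scalar_prod_def cmat_def n_def sum_distrib_left mult_ac)
    also have "\<dots> = \<nu> * Matrix.vec_index v i"
      using eq i vc by simp
    finally show "Matrix.vec_index (jnf_mat f (cmat X) *\<^sub>v v) i = Matrix.vec_index ((\<nu> / of_real c) \<cdot>\<^sub>v v) i"
      using i vc c by (simp add: field_simps)
  qed (use A0c vc in simp)
  then have "eigenvector (jnf_mat f (cmat X)) v (\<nu> / of_real c)"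
    using vc v0 A0c unfolding eigenvector_def by simp
  then have "norm (\<nu> / of_real c) \<in> norm ` spectrum (jnf_mat f (cmat X))"
    unfolding spectrum_def eigenvalue_def by auto
  from spectral_radius_mem_max(2)[OF A0c _ this] have "norm \<nu> / c \<le> spectral_radius (jnf_mat f (cmat X))"
    using c by (simp add: norm_divide n_def)
  with \<nu>n c show ?thesis by (simp add: field_simps)
qed

text \<open>Rescaling by the rate r pushes the spectral radius below 1, where
  Jordan_Normal_Form provides uniformly bounded powers.\<close>

lemma schur_stable_matpow_entry_bound:
  fixes X :: "real^'n^'n"
  assumes X: "schur_stable X"
  obtains r c where "0 < r" "r < 1" "\<And>k i j. \<bar>matpow X k $ i $ j\<bar> \<le> c * r ^ k"
proof -
  obtain f where "bij_betw f {0..<CARD('n)} (UNIV::'n set)"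
    using ex_bij_betw_nat_finite[of "UNIV::'n set"] by auto
  then have f: "bij_betw f {..<CARD('n)} (UNIV::'n set)" by (simp add: atLeast0LessThan)
  define \<rho> where "\<rho> = spectral_radius (jnf_mat f (cmat X))"
  have \<rho>1: "\<rho> < 1" unfolding \<rho>_def by (rule spectral_radius_jnf_mat_less_1[OF f X])
  have \<rho>0: "0 \<le> \<rho>"
    using spectral_radius_mem_max(1)[OF jnf_mat_carrier, of f "cmat X"] by (auto simp: \<rho>_def)
  define r where "r = (1 + \<rho>) / 2"
  have r0: "0 < r" and r1: "r < 1" and \<rho>r: "\<rho> < r" using \<rho>0 \<rho>1 by (auto simp: r_def)
  define A1 where "A1 = jnf_mat f (cmat ((1/r) *\<^sub>R X))"
  have "spectral_radius A1 \<le> (1/r) * \<rho>"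
    unfolding A1_def \<rho>_def by (rule spectral_radius_jnf_mat_scaleR_le) (use r0 in simp)
  also have "\<dots> < 1" using \<rho>r r0 by (simp add: field_simps)
  finally obtain c where c: "\<And>k. norm_bound (A1 ^\<^sub>m k) c"
    using spectral_radius_jnf_norm_bound_less_1_upper_triangular[OF jnf_mat_carrier] A1_def by blast
  define g where "g = inv_into {..<CARD('n)} f"
  have fg: "f (g i) = i" for i using f unfolding g_def
    by (meson UNIV_I bij_betw_inv_into_right)
  have gn: "g i < CARD('n)" for i using f unfolding g_def
    by (meson UNIV_I bij_betwE bij_betw_inv_into lessThan_iff)
  have "\<bar>matpow X k $ i $ j\<bar> \<le> c * r ^ k" for k i j
  proof -
    have "norm ((A1 ^\<^sub>m k) $$ (g i, g j)) \<le> c"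
      using c[of k] gn unfolding norm_bound_def A1_def by (auto simp: jnf_mat_def)
    moreover have "(A1 ^\<^sub>m k) $$ (g i, g j) = of_real ((1/r)^k * matpow X k $ i $ j)"
      unfolding A1_def jnf_mat_matpow[OF f, symmetric] using gn
      by (simp add: jnf_mat_def fg cmat_def matpow_scaleR)
    ultimately have "(1/r)^k * \<bar>matpow X k $ i $ j\<bar> \<le> c"
      using r0 by (simp add: abs_mult norm_mult norm_power norm_divide)
    then have "r^k * ((1/r)^k * \<bar>matpow X k $ i $ j\<bar>) \<le> r^k * c"
      by (rule mult_left_mono) (use r0 in simp)
    then show ?thesis using r0 by (simp add: power_one_over mult.commute)
  qed
  with r0 r1 that show ?thesis by blast
qed

lemma schur_stable_matpow_bound:
  fixes X :: "real^'n^'n"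
  assumes "schur_stable X"
  obtains C r where "0 < r" "r < 1" "0 \<le> C" "\<And>k x. norm (matpow X k *v x) \<le> C * r^k * norm x"
proof -
  obtain r c where r: "0 < r" "r < 1" and entry: "\<And>k i j. \<bar>matpow X k $ i $ j\<bar> \<le> c * r ^ k"
    by (rule schur_stable_matpow_entry_bound[OF assms]) iprover
  define C where "C = real CARD('n) * real CARD('n) * max c 0"
  have "norm (matpow X k *v x) \<le> C * r^k * norm x" for k x
  proof -
    have entry': "\<bar>matpow X k $ i $ j\<bar> \<le> max c 0 * r^k" for i j
      using r by (intro order_trans[OF entry] mult_right_mono) auto
    have "onorm ((*v) (matpow X k)) \<le> (\<Sum>i\<in>(UNIV::'n set). \<Sum>j\<in>(UNIV::'n set). max c 0 * r^k)"
      by (rule order_trans[OF onorm_le_matrix_component_sum]) (intro sum_mono entry')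
    also have "\<dots> = C * r^k" by (simp add: C_def)
    finally have "onorm ((*v) (matpow X k)) * norm x \<le> C * r^k * norm x"
      by (rule mult_right_mono) simp
    with onorm[OF matrix_vector_mul_bounded_linear, of "matpow X k" x] show ?thesis
      by linarith
  qed
  moreover have "0 \<le> C" by (simp add: C_def)
  ultimately show ?thesis using r by (intro that)
qed

lemma matrix_inv:
  assumes "invertible X"
  shows matrix_inv_left: "matrix_inv X ** X = mat 1" and matrix_inv_right: "X ** matrix_inv X = mat 1"
proof -
  have "X ** matrix_inv X = mat 1 \<and> matrix_inv X ** X = mat 1"
    unfolding matrix_inv_def using assms unfolding invertible_def by (rule someI_ex)
  then show "matrix_inv X ** X = mat 1" "X ** matrix_inv X = mat 1" by auto
qed

lemma invertible_id_minus_if_matpow_tendsto_0: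
  fixes X :: "real^'n^'n"
  assumes "\<And>x. (\<lambda>k. matpow X k *v x) \<longlonglongrightarrow> 0"
  shows "invertible (mat 1 - X)"
proof -
  have "x = 0" if "(mat 1 - X) *v x = 0" for x
  proof -
    have "X *v x = x" using that by (simp add: matrix_vector_mult_diff_rdistrib)
    then have "matpow X k *v x = x" for k
      by (induction k) (simp_all add: matrix_vector_mul_assoc[symmetric])
    then show "x = 0" using assms[of x] by (simp add: LIMSEQ_const_iff)
  qed
  then have "\<exists>B. B ** (mat 1 - X) = mat 1" by (simp add: matrix_left_invertible_ker)
  then show ?thesis by (simp add: invertible_left_inverse)
qed

lemma id_minus_mult_geometric_sum:
  "(mat 1 - X) *v (\<Sum>i<k. matpow X i *v v) = v - matpow X k *v v"
proof (induction k)
  case (Suc k)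
  have "(mat 1 - X) *v (matpow X k *v v) = matpow X k *v v - matpow X (Suc k) *v v"
    by (simp add: matrix_vector_mult_diff_rdistrib matrix_vector_mul_assoc[symmetric])
  with Suc show ?case by (simp add: matrix_vector_right_distrib)
qed simp

lemma borel_measurable_matrix_vector_mult[measurable]:
  fixes A :: "real^'n^'m"
  assumes "f \<in> borel_measurable N"
  shows "(\<lambda>x. A *v f x) \<in> borel_measurable N"
proof -
  have "((*v) A) \<in> borel_measurable borel"
    by (intro borel_measurable_continuous_onI linear_continuous_on) simp
  from measurable_compose[OF assms this] show ?thesis by (simp add: comp_def)
qed

lemma borel_measurable_vec_component[measurable]:
  fixes f :: "'b \<Rightarrow> real^'n"
  assumes "f \<in> borel_measurable N"
  shows "(\<lambda>x. f x $ i) \<in> borel_measurable N"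
  using measurable_compose[OF assms borel_measurable_continuous_onI[OF
        linear_continuous_on[OF bounded_linear_vec_nth]]]
  by simp

lemma power2_norm_add_le: "(norm (x + y))\<^sup>2 \<le> 2 * (norm x)\<^sup>2 + 2 * (norm (y::'b::real_normed_vector))\<^sup>2"
proof -
  have "(norm (x + y))\<^sup>2 \<le> (norm x + norm y)\<^sup>2"
    by (intro power_mono norm_triangle_ineq) simp
  also have "\<dots> \<le> 2 * (norm x)\<^sup>2 + 2 * (norm y)\<^sup>2"
    using zero_le_power2[of "norm x - norm y"] unfolding power2_sum power2_diff by linarith
  finally show ?thesis .
qed

lemma power2_le_3_sum_power2:
  fixes a b c d :: real
  assumes "0 \<le> d" "d \<le> a + b + c"
  shows "d\<^sup>2 \<le> 3 * a\<^sup>2 + 3 * b\<^sup>2 + 3 * c\<^sup>2"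
proof -
  have "d\<^sup>2 \<le> (a + b + c)\<^sup>2" using assms by (intro power_mono) auto
  also have "\<dots> \<le> 3 * a\<^sup>2 + 3 * b\<^sup>2 + 3 * c\<^sup>2"
    using zero_le_power2[of "a - b"] zero_le_power2[of "a - c"] zero_le_power2[of "b - c"]
    by (simp add: power2_eq_square algebra_simps)
  finally show ?thesis .
qed

lemma integrable_power2_norm_add:
  fixes f g :: "'a \<Rightarrow> 'b::euclidean_space"
  assumes [measurable]: "f \<in> borel_measurable M" "g \<in> borel_measurable M"
    and "integrable M (\<lambda>\<omega>. (norm (f \<omega>))\<^sup>2)" "integrable M (\<lambda>\<omega>. (norm (g \<omega>))\<^sup>2)"
  shows "integrable M (\<lambda>\<omega>. (norm (f \<omega> + g \<omega>))\<^sup>2)"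
  by (rule Bochner_Integration.integrable_bound[of _ "\<lambda>\<omega>. 2 * (norm (f \<omega>))\<^sup>2 + 2 * (norm (g \<omega>))\<^sup>2"])
    (use assms(3,4) power2_norm_add_le in auto)

lemma integrable_power2_norm_matrix_vector_mult:
  fixes f :: "'a \<Rightarrow> real^'n"
  assumes [measurable]: "f \<in> borel_measurable M" and "integrable M (\<lambda>\<omega>. (norm (f \<omega>))\<^sup>2)"
  shows "integrable M (\<lambda>\<omega>. (norm (A *v f \<omega>))\<^sup>2)"
proof (rule Bochner_Integration.integrable_bound[of _ "\<lambda>\<omega>. (onorm ((*v) A))\<^sup>2 * (norm (f \<omega>))\<^sup>2"])
  show "integrable M (\<lambda>\<omega>. (onorm ((*v) A))\<^sup>2 * (norm (f \<omega>))\<^sup>2)"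
    using assms(2) by simp
  have "(norm (A *v x))\<^sup>2 \<le> (onorm ((*v) A) * norm x)\<^sup>2" for x
    by (intro power_mono onorm[OF matrix_vector_mul_bounded_linear]) simp
  then show "AE \<omega> in M. norm ((norm (A *v f \<omega>))\<^sup>2) \<le> norm ((onorm ((*v) A))\<^sup>2 * (norm (f \<omega>))\<^sup>2)"
    by (simp add: power_mult_distrib)
qed measurable

lemma integrable_mult_of_power2:
  fixes g h :: "'a \<Rightarrow> real"
  assumes "g \<in> borel_measurable M" "h \<in> borel_measurable M"
    "integrable M (\<lambda>\<omega>. (g \<omega>)\<^sup>2)" "integrable M (\<lambda>\<omega>. (h \<omega>)\<^sup>2)"
  shows "integrable M (\<lambda>\<omega>. g \<omega> * h \<omega>)"
proof (rule Bochner_Integration.integrable_bound[of _ "\<lambda>\<omega>. (g \<omega>)\<^sup>2 + (h \<omega>)\<^sup>2"])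
  show "integrable M (\<lambda>\<omega>. (g \<omega>)\<^sup>2 + (h \<omega>)\<^sup>2)" using assms(3,4) by simp
  have "\<bar>x * y\<bar> \<le> x\<^sup>2 + y\<^sup>2" for x y :: real
  proof -
    have "2 * \<bar>x\<bar> * \<bar>y\<bar> \<le> x\<^sup>2 + y\<^sup>2" using sum_squares_bound[of "\<bar>x\<bar>" "\<bar>y\<bar>"] by simp
    moreover have "0 \<le> \<bar>x\<bar> * \<bar>y\<bar>" by simp
    ultimately show ?thesis unfolding abs_mult by linarith
  qed
  then show "AE \<omega> in M. norm (g \<omega> * h \<omega>) \<le> norm ((g \<omega>)\<^sup>2 + (h \<omega>)\<^sup>2)" by simp
qed (use assms(1,2) in measurable)

lemma nn_integral_mult_le_of_power2_le:
  fixes f g :: "'a \<Rightarrow> real"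
  assumes [measurable]: "f \<in> borel_measurable M" "g \<in> borel_measurable M"
    and nonneg: "\<And>\<omega>. 0 \<le> f \<omega>" "\<And>\<omega>. 0 \<le> g \<omega>"
    and f: "(\<integral>\<^sup>+ \<omega>. ennreal ((f \<omega>)\<^sup>2) \<partial>M) \<le> s" and g: "(\<integral>\<^sup>+ \<omega>. ennreal ((g \<omega>)\<^sup>2) \<partial>M) \<le> s"
  shows "(\<integral>\<^sup>+ \<omega>. ennreal (f \<omega>) * ennreal (g \<omega>) \<partial>M) \<le> s"
proof -
  have "(\<integral>\<^sup>+ \<omega>. ennreal (f \<omega>) * ennreal (g \<omega>) \<partial>M)
      \<le> (\<integral>\<^sup>+ \<omega>. ennreal (1/2) * (ennreal ((f \<omega>)\<^sup>2) + ennreal ((g \<omega>)\<^sup>2)) \<partial>M)"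
  proof (rule nn_integral_mono)
    fix \<omega>
    have "f \<omega> * g \<omega> \<le> 1/2 * ((f \<omega>)\<^sup>2 + (g \<omega>)\<^sup>2)"
      using sum_squares_bound[of "f \<omega>" "g \<omega>"] by (simp add: power2_eq_square)
    then have "ennreal (f \<omega> * g \<omega>) \<le> ennreal (1/2 * ((f \<omega>)\<^sup>2 + (g \<omega>)\<^sup>2))"
      by (rule ennreal_leI)
    moreover have "0 \<le> (f \<omega>)\<^sup>2 + (g \<omega>)\<^sup>2" "0 \<le> (1::real) / 2" "0 \<le> (f \<omega>)\<^sup>2" "0 \<le> (g \<omega>)\<^sup>2"
      by simp_all
    ultimately show "ennreal (f \<omega>) * ennreal (g \<omega>) \<le> ennreal (1/2) * (ennreal ((f \<omega>)\<^sup>2) + ennreal ((g \<omega>)\<^sup>2))"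
      using nonneg by (simp only: ennreal_mult ennreal_plus)
  qed
  also have "\<dots> = ennreal (1/2) * ((\<integral>\<^sup>+ \<omega>. ennreal ((f \<omega>)\<^sup>2) \<partial>M) + (\<integral>\<^sup>+ \<omega>. ennreal ((g \<omega>)\<^sup>2) \<partial>M))"
    by (simp add: nn_integral_cmult nn_integral_add)
  also have "\<dots> \<le> ennreal (1/2) * (s + s)"
    by (intro mult_left_mono add_mono f g) auto
  also have "\<dots> = (ennreal (1/2) + ennreal (1/2)) * s"
    by (simp add: distrib_left distrib_right)
  also have "ennreal (1/2) + ennreal (1/2) = 1"
    by (simp only: ennreal_plus[symmetric]) simp_all
  finally show ?thesis by simp
qed

text \<open>A Minkowski-type bound: the weights b pass through the square of the series, because
  each cross term is controlled by the common second-moment bound s.\<close>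

lemma nn_integral_power2_suminf_le:
  fixes f :: "nat \<Rightarrow> 'a \<Rightarrow> real" and b :: "nat \<Rightarrow> real"
  assumes [measurable]: "\<And>j. f j \<in> borel_measurable M"
    and nonneg: "\<And>j \<omega>. 0 \<le> f j \<omega>" "\<And>j. 0 \<le> b j"
    and second_moment: "\<And>j. (\<integral>\<^sup>+ \<omega>. ennreal ((f j \<omega>)\<^sup>2) \<partial>M) \<le> s"
  shows "(\<integral>\<^sup>+ \<omega>. (\<Sum>j. ennreal (b j * f j \<omega>))\<^sup>2 \<partial>M) \<le> (\<Sum>j. ennreal (b j))\<^sup>2 * s"
proof -
  have square: "(\<Sum>j. x j)\<^sup>2 = (\<Sum>j. \<Sum>l. x j * x l)" for x :: "nat \<Rightarrow> ennreal"
    by (simp add: power2_eq_square ennreal_suminf_cmult ennreal_suminf_multc)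
  have product: "ennreal (b j * f j \<omega>) * ennreal (b l * f l \<omega>)
      = ennreal (b j) * ennreal (b l) * (ennreal (f j \<omega>) * ennreal (f l \<omega>))" for j l \<omega>
    using nonneg by (simp add: ennreal_mult mult_ac)
  have "(\<integral>\<^sup>+ \<omega>. (\<Sum>j. ennreal (b j * f j \<omega>))\<^sup>2 \<partial>M)
      = (\<Sum>j. \<Sum>l. \<integral>\<^sup>+ \<omega>. ennreal (b j * f j \<omega>) * ennreal (b l * f l \<omega>) \<partial>M)"
    unfolding square by (simp add: nn_integral_suminf[symmetric])
  also have "\<dots> = (\<Sum>j. \<Sum>l. ennreal (b j) * ennreal (b l) * \<integral>\<^sup>+ \<omega>. ennreal (f j \<omega>) * ennreal (f l \<omega>) \<partial>M)"
    unfolding product by (simp add: nn_integral_cmult)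
  also have "\<dots> \<le> (\<Sum>j. \<Sum>l. ennreal (b j) * ennreal (b l) * s)"
    by (intro suminf_le allI mult_left_mono nn_integral_mult_le_of_power2_le second_moment nonneg) auto
  also have "\<dots> = (\<Sum>j. ennreal (b j))\<^sup>2 * s"
    by (simp add: square ennreal_suminf_multc)
  finally show ?thesis .
qed

lemma distr_pair_snd:
  assumes "prob_space M1" "sigma_finite_measure M2"
  shows "distr (M1 \<Otimes>\<^sub>M M2) M2 snd = M2"
proof (intro measure_eqI)
  interpret M1: prob_space M1 by fact
  interpret M2: sigma_finite_measure M2 by fact
  fix A assume A: "A \<in> sets (distr (M1 \<Otimes>\<^sub>M M2) M2 snd)"
  from A have "emeasure (distr (M1 \<Otimes>\<^sub>M M2) M2 snd) A = emeasure (M1 \<Otimes>\<^sub>M M2) (space M1 \<times> A)"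
    by (auto simp add: emeasure_distr space_pair_measure dest: sets.sets_into_space
        intro!: arg_cong2[where f=emeasure])
  with A show "emeasure (distr (M1 \<Otimes>\<^sub>M M2) M2 snd) A = emeasure M2 A"
    by (simp add: M2.emeasure_pair_measure_Times M1.emeasure_space_1)
qed simp

lemma weak_conv_law_of_AE_tendsto:
  fixes Y :: "nat \<Rightarrow> 'a \<Rightarrow> 'b::euclidean_space" and Z :: "'a \<Rightarrow> 'b"
  assumes "prob_space M"
    and [measurable]: "\<And>k. Y k \<in> borel_measurable M" "Z \<in> borel_measurable M"
    and tendsto: "AE \<omega> in M. (\<lambda>k. Y k \<omega>) \<longlonglongrightarrow> Z \<omega>"
  shows "weak_conv_law (\<lambda>k. distr M borel (Y k)) (distr M borel Z)"
  unfolding weak_conv_law_def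
proof (intro allI impI)
  interpret prob_space M by fact
  fix f :: "'b \<Rightarrow> real"
  assume f: "continuous_on UNIV f \<and> bounded (range f)"
  then have [measurable]: "f \<in> borel_measurable borel" by (intro borel_measurable_continuous_onI) simp
  from f obtain B where B: "\<And>x. norm (f x) \<le> B"
    unfolding bounded_iff by auto
  have cont: "isCont f x" for x using f by (simp add: continuous_on_eq_continuous_at)
  have "AE \<omega> in M. (\<lambda>k. f (Y k \<omega>)) \<longlonglongrightarrow> f (Z \<omega>)"
    using tendsto by eventually_elim (rule isCont_tendsto_compose[OF cont])
  then have "(\<lambda>k. \<integral>\<omega>. f (Y k \<omega>) \<partial>M) \<longlonglongrightarrow> (\<integral>\<omega>. f (Z \<omega>) \<partial>M)"
    by (intro integral_dominated_convergence[where w="\<lambda>_. B"]) (use B in auto)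
  then show "(\<lambda>k. \<integral>x. f x \<partial>distr M borel (Y k)) \<longlonglongrightarrow> (\<integral>x. f x \<partial>distr M borel Z)"
    by (simp add: integral_distr)
qed

text \<open>The joint law of Y k and Z is a coupling of their laws.\<close>

lemma W2_conv_law_of_nn_integral_tendsto:
  fixes Y :: "nat \<Rightarrow> 'a \<Rightarrow> 'b::euclidean_space" and Z :: "'a \<Rightarrow> 'b"
  assumes "prob_space M"
    and [measurable]: "\<And>k. Y k \<in> borel_measurable M" "Z \<in> borel_measurable M"
    and tendsto: "(\<lambda>k. \<integral>\<^sup>+ \<omega>. ennreal ((dist (Y k \<omega>) (Z \<omega>))\<^sup>2) \<partial>M) \<longlonglongrightarrow> 0"
  shows "W2_conv_law (\<lambda>k. distr M borel (Y k)) (distr M borel Z)"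
  unfolding W2_conv_law_def
proof (rule tendsto_sandwich[OF _ _ tendsto_const tendsto])
  show "\<forall>\<^sub>F k in sequentially. 0 \<le> wasserstein2_sq (distr M borel (Y k)) (distr M borel Z)"
    by simp
  have "wasserstein2_sq (distr M borel (Y k)) (distr M borel Z)
      \<le> (\<integral>\<^sup>+ \<omega>. ennreal ((dist (Y k \<omega>) (Z \<omega>))\<^sup>2) \<partial>M)" for k
  proof -
    define \<pi> where "\<pi> = distr M (borel \<Otimes>\<^sub>M borel) (\<lambda>\<omega>. (Y k \<omega>, Z \<omega>))"
    have pair[measurable]: "(\<lambda>\<omega>. (Y k \<omega>, Z \<omega>)) \<in> measurable M (borel \<Otimes>\<^sub>M borel)"
      by measurable
    have "\<pi> \<in> couplings (distr M borel (Y k)) (distr M borel Z)"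
      unfolding couplings_def \<pi>_def
      using prob_space.prob_space_distr[OF assms(1) pair]
      by (simp add: distr_distr comp_def)
    then have "wasserstein2_sq (distr M borel (Y k)) (distr M borel Z)
        \<le> (\<integral>\<^sup>+ p. ennreal ((dist (fst p) (snd p))\<^sup>2) \<partial>\<pi>)"
      unfolding wasserstein2_sq_def by (rule INF_lower)
    also have "\<dots> = (\<integral>\<^sup>+ \<omega>. ennreal ((dist (Y k \<omega>) (Z \<omega>))\<^sup>2) \<partial>M)"
      unfolding \<pi>_def by (simp add: nn_integral_distr)
    finally show ?thesis .
  qed
  then show "\<forall>\<^sub>F k in sequentially. wasserstein2_sq (distr M borel (Y k)) (distr M borel Z)
      \<le> (\<integral>\<^sup>+ \<omega>. ennreal ((dist (Y k \<omega>) (Z \<omega>))\<^sup>2) \<partial>M)"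
    by simp
qed

lemma nn_integral_dist_power2_lipschitz_tendsto:
  fixes Y :: "nat \<Rightarrow> 'a \<Rightarrow> 'b::euclidean_space" and Z :: "'a \<Rightarrow> 'b"
    and h :: "'b \<Rightarrow> 'c::euclidean_space"
  assumes h: "L-lipschitz_on UNIV h"
    and [measurable]: "\<And>k. Y k \<in> borel_measurable M" "Z \<in> borel_measurable M"
    and tendsto: "(\<lambda>k. \<integral>\<^sup>+ \<omega>. ennreal ((dist (Y k \<omega>) (Z \<omega>))\<^sup>2) \<partial>M) \<longlonglongrightarrow> 0"
  shows "(\<lambda>k. \<integral>\<^sup>+ \<omega>. ennreal ((dist (h (Y k \<omega>)) (h (Z \<omega>)))\<^sup>2) \<partial>M) \<longlonglongrightarrow> 0"
proof (rule tendsto_sandwich[OF _ _ tendsto_const])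
  have L: "0 \<le> L" using h by (rule lipschitz_on_nonneg)
  have "(dist (h x) (h y))\<^sup>2 \<le> L\<^sup>2 * (dist x y)\<^sup>2" for x y
    using power_mono[OF lipschitz_onD[OF h] zero_le_dist] by (simp add: power_mult_distrib)
  then have "(\<integral>\<^sup>+ \<omega>. ennreal ((dist (h (Y k \<omega>)) (h (Z \<omega>)))\<^sup>2) \<partial>M)
      \<le> (\<integral>\<^sup>+ \<omega>. ennreal (L\<^sup>2) * ennreal ((dist (Y k \<omega>) (Z \<omega>))\<^sup>2) \<partial>M)" for k
    by (intro nn_integral_mono) (simp add: ennreal_mult[symmetric] ennreal_leI)
  also have "\<dots> k = ennreal (L\<^sup>2) * (\<integral>\<^sup>+ \<omega>. ennreal ((dist (Y k \<omega>) (Z \<omega>))\<^sup>2) \<partial>M)" for k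
    by (simp add: nn_integral_cmult)
  finally show "\<forall>\<^sub>F k in sequentially. (\<integral>\<^sup>+ \<omega>. ennreal ((dist (h (Y k \<omega>)) (h (Z \<omega>)))\<^sup>2) \<partial>M)
      \<le> ennreal (L\<^sup>2) * (\<integral>\<^sup>+ \<omega>. ennreal ((dist (Y k \<omega>) (Z \<omega>))\<^sup>2) \<partial>M)"
    by simp
  show "(\<lambda>k. ennreal (L\<^sup>2) * (\<integral>\<^sup>+ \<omega>. ennreal ((dist (Y k \<omega>) (Z \<omega>))\<^sup>2) \<partial>M)) \<longlonglongrightarrow> 0"
    using ennreal_tendsto_cmult[OF _ tendsto, of "ennreal (L\<^sup>2)"] by simp
qed simp

lemma lipschitz_on_matrix_affine:
  fixes K :: "real^'n^'m"
  shows "lipschitz_on (onorm ((*v) K)) U (\<lambda>x. K *v x + c)"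
proof (rule lipschitz_onI)
  show "dist (K *v x + c) (K *v y + c) \<le> onorm ((*v) K) * dist x y" for x y
    using onorm[OF matrix_vector_mul_bounded_linear, of K "x - y"]
    by (simp add: dist_norm matrix_vector_mult_diff_distrib)
qed (rule onorm_pos_le[OF matrix_vector_mul_bounded_linear])

lemma closed_loop_eq:
  fixes A :: "real^'nx^'nx" and B :: "real^'nu^'nx" and E :: "real^'nw^'nx"
  assumes "At = A + B ** K" "Ft = B ** F + E"
  shows "A *v x + B *v (K *v x + F *v c) + E *v w = At *v x + Ft *v c + E *v (w - c)"
  using assms
  by (simp add: matrix_vector_mult_add_rdistrib matrix_vector_right_distrib
      matrix_vector_mul_assoc[symmetric] matrix_vector_mult_diff_distrib algebra_simps)

lemma stationary_pair_feedbackI: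
  fixes K :: "real^'nx^'nu" and c :: "real^'nu"
  assumes "prob_space N" and [measurable]: "Xb \<in> borel_measurable N"
    and square_integrable: "integrable N (\<lambda>\<omega>. (norm (Xb \<omega>))\<^sup>2)"
    and law: "distr N borel Xb = distr (N \<Otimes>\<^sub>M \<mu>W) borel
        (\<lambda>(\<omega>, w). A *v Xb \<omega> + B *v (K *v Xb \<omega> + c) + E *v w)"
  shows "stationary_pair A B E \<mu>W N Xb (\<lambda>\<omega>. K *v Xb \<omega> + c)"
proof -
  interpret prob_space N by fact
  have "integrable N (\<lambda>\<omega>. (norm (K *v Xb \<omega> + c))\<^sup>2)"
    by (intro integrable_power2_norm_add integrable_power2_norm_matrix_vector_mult square_integrable)
      auto
  with square_integrable law show ?thesis
    unfolding stationary_pair_def by simp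
qed

lemma distr_pair_measure_eq_if_distr_eq:
  assumes "prob_space N" "prob_space N'" "sigma_finite_measure \<mu>"
    and [measurable]: "f \<in> borel_measurable N" "f' \<in> borel_measurable N'" "g \<in> borel_measurable (borel \<Otimes>\<^sub>M \<mu>)"
    and law: "distr N borel f = distr N' borel f'"
  shows "distr (N \<Otimes>\<^sub>M \<mu>) borel (\<lambda>p. g (f (fst p), snd p)) = distr (N' \<Otimes>\<^sub>M \<mu>) borel (\<lambda>p. g (f' (fst p), snd p))"
proof -
  have via_law: "distr (L \<Otimes>\<^sub>M \<mu>) borel (\<lambda>p. g (h (fst p), snd p)) = distr (distr L borel h \<Otimes>\<^sub>M \<mu>) borel g"
    if "prob_space L" and [measurable]: "h \<in> borel_measurable L" for L h
  proof -
    have pair: "distr L borel h \<Otimes>\<^sub>M distr \<mu> \<mu> (\<lambda>x. x) = distr (L \<Otimes>\<^sub>M \<mu>) (borel \<Otimes>\<^sub>M \<mu>) (\<lambda>(x, y). (h x, y))"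
      using assms(3) prob_space.prob_space_distr[OF that(1), of h borel]
      by (intro pair_measure_distr) (auto intro: prob_space_imp_sigma_finite)
    have "distr (L \<Otimes>\<^sub>M \<mu>) borel (\<lambda>p. g (h (fst p), snd p)) = distr (L \<Otimes>\<^sub>M \<mu>) borel (g \<circ> (\<lambda>(x, y). (h x, y)))"
      by (simp add: comp_def case_prod_beta)
    also have "\<dots> = distr (distr (L \<Otimes>\<^sub>M \<mu>) (borel \<Otimes>\<^sub>M \<mu>) (\<lambda>(x, y). (h x, y))) borel g"
      by (rule distr_distr[symmetric]) measurable
    finally show ?thesis by (simp flip: pair)
  qed
  show ?thesis
    unfolding via_law[OF assms(1,4)] via_law[OF assms(2,5)] law ..
qed

lemma (in prob_space) distr_pair_eq_pair_measure_if_indep_set: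
  assumes [measurable]: "X \<in> measurable M S" "Y \<in> measurable M T"
    and indep: "indep_set {X -` A \<inter> space M | A. A \<in> sets S} {Y -` A \<inter> space M | A. A \<in> sets T}"
  shows "distr M (S \<Otimes>\<^sub>M T) (\<lambda>\<omega>. (X \<omega>, Y \<omega>)) = distr M S X \<Otimes>\<^sub>M distr M T Y"
proof -
  interpret S: prob_space "distr M S X" by (rule prob_space_distr) simp
  interpret T: prob_space "distr M T Y" by (rule prob_space_distr) simp
  show ?thesis
  proof (rule pair_measure_eqI[symmetric])
    fix A B assume A: "A \<in> sets (distr M S X)" and B: "B \<in> sets (distr M T Y)"
    have "(\<lambda>\<omega>. (X \<omega>, Y \<omega>)) -` (A \<times> B) \<inter> space M = (X -` A \<inter> space M) \<inter> (Y -` B \<inter> space M)"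
      by auto
    moreover have "emeasure M ((X -` A \<inter> space M) \<inter> (Y -` B \<inter> space M))
        = emeasure M (X -` A \<inter> space M) * emeasure M (Y -` B \<inter> space M)"
      using indep_setD[OF indep, of "X -` A \<inter> space M" "Y -` B \<inter> space M"] A B
      by (auto simp: emeasure_eq_measure ennreal_mult[symmetric] measure_nonneg)
    ultimately show "emeasure (distr M S X) A * emeasure (distr M T Y) B
        = emeasure (distr M (S \<Otimes>\<^sub>M T) (\<lambda>\<omega>. (X \<omega>, Y \<omega>))) (A \<times> B)"
      using A B by (simp add: emeasure_distr)
  qed (simp_all add: S.sigma_finite_measure_axioms T.sigma_finite_measure_axioms)
qed

locale iid_noise = prob_space M for M :: "'a measure" +
  fixes W :: "nat \<Rightarrow> 'a \<Rightarrow> real^'nw"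
  assumes W_measurable[measurable]: "\<And>k. W k \<in> borel_measurable M"
    and W_square_integrable: "\<And>k. integrable M (\<lambda>\<omega>. (norm (W k \<omega>))\<^sup>2)"
    and W_identically_distributed: "\<And>k. distr M borel (W k) = distr M borel (W 0)"
    and W_indep: "indep_vars (\<lambda>_. borel) W UNIV"
begin

definition "w_mean = (\<integral>\<omega>. W 0 \<omega> \<partial>M)"
definition "w_law = distr M borel (W 0)"
definition "path_law = PiM UNIV (\<lambda>_::nat. w_law)"
abbreviation "borel_paths \<equiv> PiM UNIV (\<lambda>_::nat. (borel :: (real^'nw) measure))"
definition "w_path \<omega> = (\<lambda>j. W j \<omega>)"
definition "w_var = (\<integral>\<^sup>+ \<omega>. ennreal ((norm (W 0 \<omega> - w_mean))\<^sup>2) \<partial>M)"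

lemma sets_w_law[simp, measurable_cong]: "sets w_law = sets borel"
  by (simp add: w_law_def)

lemma space_w_law[simp]: "space w_law = UNIV"
  by (simp add: w_law_def)

lemma prob_space_w_law: "prob_space w_law"
  unfolding w_law_def by (rule prob_space_distr) simp

lemma sets_path_law[measurable_cong]: "sets path_law = sets borel_paths"
  unfolding path_law_def by (rule sets_PiM_cong) auto

lemma prob_space_path_law: "prob_space path_law"
  unfolding path_law_def using prob_space_w_law by (intro prob_space_PiM) auto

lemma measurable_w_path[measurable]: "w_path \<in> measurable M borel_paths"
  unfolding w_path_def by (rule measurable_PiM_single') auto

lemma measurable_w_path_path_law: "w_path \<in> measurable M path_law"
  using measurable_w_path by (simp cong: measurable_cong_sets add: sets_path_law)

lemma distr_w_path: "distr M borel_paths w_path = path_law"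
proof -
  have "distr M borel_paths (\<lambda>x. \<lambda>i\<in>UNIV. W i x) = (\<Pi>\<^sub>M i\<in>UNIV. distr M borel (W i))"
    using indep_vars_iff_distr_eq_PiM'[where I=UNIV and M'="\<lambda>_. borel" and X=W] W_indep by simp
  moreover have "(\<Pi>\<^sub>M i\<in>UNIV. distr M borel (W i)) = path_law"
    unfolding path_law_def w_law_def by (rule PiM_cong) (auto intro: W_identically_distributed)
  ultimately show ?thesis
    by (simp add: w_path_def[abs_def] restrict_UNIV)
qed

lemma distr_w_path_path_law: "distr M path_law w_path = path_law"
  using distr_w_path by (metis distr_cong sets_path_law)

lemma nn_integral_path_law:
  assumes "g \<in> borel_measurable borel_paths"
  shows "(\<integral>\<^sup>+ \<omega>. g \<omega> \<partial>path_law) = (\<integral>\<^sup>+ \<omega>. g (w_path \<omega>) \<partial>M)"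
  using assms by (simp add: distr_w_path[symmetric] nn_integral_distr)

lemma nn_integral_W_eq:
  assumes [measurable]: "g \<in> borel_measurable borel"
  shows "(\<integral>\<^sup>+ \<omega>. g (W j \<omega>) \<partial>M) = (\<integral>\<^sup>+ \<omega>. g (W 0 \<omega>) \<partial>M)"
proof -
  have "(\<integral>\<^sup>+ \<omega>. g (W j \<omega>) \<partial>M) = (\<integral>\<^sup>+ x. g x \<partial>distr M borel (W j))"
    by (simp add: nn_integral_distr)
  also have "\<dots> = (\<integral>\<^sup>+ x. g x \<partial>distr M borel (W 0))" by (simp only: W_identically_distributed[of j])
  also have "\<dots> = (\<integral>\<^sup>+ \<omega>. g (W 0 \<omega>) \<partial>M)" by (simp add: nn_integral_distr)
  finally show ?thesis .
qed

lemma integral_W_eq: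
  fixes g :: "real^'nw \<Rightarrow> 'b::{banach, second_countable_topology}"
  assumes [measurable]: "g \<in> borel_measurable borel"
  shows "(\<integral>\<omega>. g (W j \<omega>) \<partial>M) = (\<integral>\<omega>. g (W 0 \<omega>) \<partial>M)"
proof -
  have "(\<integral>\<omega>. g (W j \<omega>) \<partial>M) = (\<integral>x. g x \<partial>distr M borel (W j))"
    by (simp add: integral_distr)
  also have "\<dots> = (\<integral>x. g x \<partial>distr M borel (W 0))" by (simp only: W_identically_distributed[of j])
  also have "\<dots> = (\<integral>\<omega>. g (W 0 \<omega>) \<partial>M)" by (simp add: integral_distr)
  finally show ?thesis .
qed

lemma integrable_W: "integrable M (W j)"
  using square_integrable_imp_integrable[of "\<lambda>\<omega>. norm (W j \<omega>)"] W_square_integrable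
  by (simp add: integrable_norm_iff)

lemma integral_W: "(\<integral>\<omega>. W j \<omega> \<partial>M) = w_mean"
  unfolding w_mean_def using integral_W_eq[of "\<lambda>x. x"] by simp

lemma integrable_centered_W: "integrable M (\<lambda>\<omega>. W j \<omega> - w_mean)"
  using integrable_W by simp

lemma integral_centered_W: "(\<integral>\<omega>. W j \<omega> - w_mean \<partial>M) = 0"
  using integrable_W by (simp add: integral_W prob_space)

lemma integrable_power2_norm_centered_W: "integrable M (\<lambda>\<omega>. (norm (W j \<omega> - w_mean))\<^sup>2)"
  using integrable_power2_norm_add[of "W j" M "\<lambda>_. - w_mean"] W_square_integrable by simp

lemma integrable_power2_centered_W_component: "integrable M (\<lambda>\<omega>. ((W j \<omega> - w_mean) $ p)\<^sup>2)"
proof (rule Bochner_Integration.integrable_bound[OF integrable_power2_norm_centered_W[of j]])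
  have "((x - w_mean) $ p)\<^sup>2 \<le> (norm (x - w_mean))\<^sup>2" for x :: "real^'nw"
    using power_mono[OF component_le_norm_cart abs_ge_zero, of "x - w_mean" p 2] by simp
  then show "AE \<omega> in M. norm (((W j \<omega> - w_mean) $ p)\<^sup>2) \<le> norm ((norm (W j \<omega> - w_mean))\<^sup>2)"
    by simp
qed measurable

lemma w_var_eq: "(\<integral>\<^sup>+ \<omega>. ennreal ((norm (W j \<omega> - w_mean))\<^sup>2) \<partial>M) = w_var"
  unfolding w_var_def by (rule nn_integral_W_eq[of "\<lambda>x. ennreal ((norm (x - w_mean))\<^sup>2)"]) measurable

lemma w_var_finite: "w_var < \<infinity>"
  using integrableD(2)[OF integrable_power2_norm_centered_W[of 0]] by (simp add: w_var_def less_top)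

lemma mean_w_law: "mean_law w_law = w_mean"
  unfolding mean_law_def w_law_def w_mean_def by (simp add: integral_distr)

lemma cov_w_law_eq: "cov_law w_law $ p $ q = (\<integral>\<omega>. (W j \<omega> - w_mean) $ p * (W j \<omega> - w_mean) $ q \<partial>M)"
proof -
  have "cov_law w_law $ p $ q = (\<integral>\<omega>. (W 0 \<omega> - w_mean) $ p * (W 0 \<omega> - w_mean) $ q \<partial>M)"
    unfolding cov_law_def mean_w_law unfolding w_law_def by (simp add: integral_distr)
  then show ?thesis
    using integral_W_eq[of "\<lambda>x. (x - w_mean) $ p * (x - w_mean) $ q" j] by simp
qed

lemma measurable_path_reindex[measurable]: "(\<lambda>\<omega>. \<omega> \<circ> \<sigma>) \<in> measurable borel_paths borel_paths"
  unfolding comp_def by (rule measurable_PiM_single') auto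

lemma distr_path_law_reindex:
  assumes "inj \<sigma>"
  shows "distr path_law path_law (\<lambda>\<omega>. \<omega> \<circ> \<sigma>) = path_law"
proof -
  have "distr (PiM UNIV (\<lambda>_::nat. w_law)) (PiM UNIV (\<lambda>i. (\<lambda>_. w_law) (\<sigma> i))) (\<lambda>\<omega>. \<lambda>n\<in>UNIV. \<omega> (\<sigma> n))
      = PiM UNIV (\<lambda>i. (\<lambda>_. w_law) (\<sigma> i))"
    by (rule distr_PiM_reindex) (use assms prob_space_w_law in auto)
  then show ?thesis by (simp add: path_law_def restrict_UNIV comp_def)
qed

lemma measurable_path_shift: "(\<lambda>(\<omega>, w). case_nat w \<omega>) \<in> measurable (path_law \<Otimes>\<^sub>M w_law) path_law"
proof -
  have "(\<lambda>p. case_nat (snd p) (fst p)) \<in> measurable (path_law \<Otimes>\<^sub>M w_law) (PiM UNIV (\<lambda>_. w_law))"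
    by (rule measurable_PiM_single') (auto split: nat.split simp: path_law_def)
  then show ?thesis by (simp add: path_law_def case_prod_beta')
qed

text \<open>The time shift of a noise path is assembled from moving the path to the indices
  1, 2, ... and filling in index 0 with an independent noise value.\<close>

definition "tail_law = PiM {Suc 0..} (\<lambda>_. w_law)"
definition "shift_right (\<omega> :: nat \<Rightarrow> real^'nw) = (\<lambda>n\<in>{Suc 0..}. \<omega> (n - 1))"

lemma prob_space_tail_law: "prob_space tail_law"
  unfolding tail_law_def using prob_space_w_law by (intro prob_space_PiM) auto

lemma measurable_shift_right: "shift_right \<in> measurable path_law tail_law"
  unfolding shift_right_def tail_law_def path_law_def by measurable

lemma distr_shift_right: "distr path_law tail_law shift_right = tail_law"
proof -
  have "distr (PiM UNIV (\<lambda>_::nat. w_law)) (PiM {Suc 0..} (\<lambda>i. (\<lambda>_. w_law) (i - 1))) (\<lambda>\<omega>. \<lambda>n\<in>{Suc 0..}. \<omega> (n - 1))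
      = PiM {Suc 0..} (\<lambda>i. (\<lambda>_. w_law) (i - 1))"
    by (rule distr_PiM_reindex) (auto simp: inj_on_def prob_space_w_law)
  then show ?thesis by (simp add: path_law_def tail_law_def shift_right_def[abs_def])
qed

lemma measurable_fill_0: "(\<lambda>(x, X). X(0 := x)) \<in> measurable (w_law \<Otimes>\<^sub>M tail_law) path_law"
proof -
  have "(\<lambda>p. (snd p) (0 := fst p)) \<in> measurable (w_law \<Otimes>\<^sub>M tail_law) (PiM ({Suc 0..} \<union> {0}) (\<lambda>_. w_law))"
    by (rule measurable_fun_upd[where J="{Suc 0..}"]) (auto simp: tail_law_def)
  moreover have "{Suc 0..} \<union> {0} = UNIV" by auto
  ultimately show ?thesis by (simp add: path_law_def case_prod_beta')
qed

lemma distr_fill_0: "distr (w_law \<Otimes>\<^sub>M tail_law) path_law (\<lambda>(x, X). X(0 := x)) = path_law"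
proof -
  have "distr ((\<lambda>_. w_law) 0 \<Otimes>\<^sub>M (\<Pi>\<^sub>M i\<in>{Suc 0..}. (\<lambda>_. w_law) i))
      (\<Pi>\<^sub>M i\<in>insert 0 {Suc 0..}. (\<lambda>_. w_law) i) (\<lambda>(x, X). X(0 := x)) = (\<Pi>\<^sub>M i\<in>insert 0 {Suc 0..}. (\<lambda>_. w_law) i)"
    by (rule distr_pair_PiM_eq_PiM) (auto simp: prob_space_w_law)
  moreover have "insert 0 {Suc 0..} = UNIV" by auto
  ultimately show ?thesis by (simp add: path_law_def tail_law_def)
qed

lemma distr_path_law_shift: "distr (path_law \<Otimes>\<^sub>M w_law) path_law (\<lambda>(\<omega>, w). case_nat w \<omega>) = path_law"
proof -
  interpret w_law: prob_space w_law by (rule prob_space_w_law)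
  interpret tail_law: prob_space tail_law by (rule prob_space_tail_law)
  interpret pair_sigma_finite w_law path_law
    using prob_space_path_law by (simp add: pair_sigma_finite_def prob_space_imp_sigma_finite w_law.sigma_finite_measure_axioms)
  define swap where "swap = (\<lambda>(\<omega>::nat \<Rightarrow> real^'nw, x::real^'nw). (x, \<omega>))"
  define shift where "shift = (\<lambda>(x::real^'nw, \<omega>). (x, shift_right \<omega>))"
  have swap_measurable: "swap \<in> measurable (path_law \<Otimes>\<^sub>M w_law) (w_law \<Otimes>\<^sub>M path_law)"
    unfolding swap_def by measurable
  have shift_measurable: "shift \<in> measurable (w_law \<Otimes>\<^sub>M path_law) (w_law \<Otimes>\<^sub>M tail_law)"
    unfolding shift_def using measurable_shift_right by measurable
  have swap_law: "distr (path_law \<Otimes>\<^sub>M w_law) (w_law \<Otimes>\<^sub>M path_law) swap = w_law \<Otimes>\<^sub>M path_law"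
    unfolding swap_def by (rule distr_pair_swap[symmetric])
  have shift_law: "distr (w_law \<Otimes>\<^sub>M path_law) (w_law \<Otimes>\<^sub>M tail_law) shift = w_law \<Otimes>\<^sub>M tail_law"
    using pair_measure_distr[of "\<lambda>x. x" w_law w_law shift_right path_law tail_law]
    by (simp add: shift_def distr_shift_right measurable_shift_right tail_law.sigma_finite_measure_axioms
        w_law.sigma_finite_measure_axioms)
  have "distr (path_law \<Otimes>\<^sub>M w_law) path_law (((\<lambda>(x, X). X(0 := x)) \<circ> shift) \<circ> swap)
      = distr (w_law \<Otimes>\<^sub>M path_law) path_law ((\<lambda>(x, X). X(0 := x)) \<circ> shift)"
    by (subst distr_distr[symmetric, OF measurable_comp[OF shift_measurable measurable_fill_0] swap_measurable])
      (simp only: swap_law)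
  also have "\<dots> = path_law"
    by (subst distr_distr[symmetric, OF measurable_fill_0 shift_measurable]) (simp only: shift_law distr_fill_0)
  finally have "distr (path_law \<Otimes>\<^sub>M w_law) path_law ((\<lambda>(x, X). X(0 := x)) \<circ> shift \<circ> swap) = path_law" .
  moreover have "(\<lambda>(x, X). X(0 := x)) \<circ> shift \<circ> swap = (\<lambda>(\<omega>, w). case_nat w \<omega>)"
    by (auto simp: fun_eq_iff swap_def shift_def shift_right_def split: nat.split)
  ultimately show ?thesis by simp
qed

end

text \<open>At and Ft stand for the closed-loop matrices A + B K and B F + E. The noise enters
  centred, so its mean only contributes the constant drift Ft w_mean.\<close>

locale stable_noise_filter = iid_noise M W for M :: "'a measure" and W :: "nat \<Rightarrow> 'a \<Rightarrow> real^'nw" +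
  fixes At :: "real^'nx^'nx" and E :: "real^'nw^'nx" and Ft :: "real^'nw^'nx" and C r :: real
  assumes rate_pos: "0 < r" and rate_less_1: "r < 1" and C_nonneg: "0 \<le> C"
    and matpow_bound: "\<And>k x. norm (matpow At k *v x) \<le> C * r^k * norm x"
begin

abbreviation "resolvent \<equiv> matrix_inv (mat 1 - At)"

definition "gain j = C * r^j * onorm ((*v) E)"
definition "noise_series \<omega> = (\<Sum>j. matpow At j *v (E *v (\<omega> j - w_mean)))"
definition "equilibrium = resolvent ** Ft *v w_mean"
definition "limit_state \<omega> = equilibrium + noise_series \<omega>"
definition "summable_path \<omega> \<longleftrightarrow> summable (\<lambda>j. gain j * norm (\<omega> j - w_mean))"
definition "tail_sum k \<omega> = (\<Sum>j. gain (j + k) * norm (\<omega> (j + k) - w_mean))"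

lemma gain_nonneg: "0 \<le> gain j"
  unfolding gain_def using C_nonneg rate_pos onorm_pos_le[OF matrix_vector_mul_bounded_linear, of E]
  by simp

lemma gain_shift_sums: "(\<lambda>j. gain (j + k)) sums (C * onorm ((*v) E) * r^k / (1 - r))"
proof -
  have "(\<lambda>j. r^j) sums (1 / (1 - r))" using geometric_sums[of r] rate_pos rate_less_1 by simp
  then have "(\<lambda>j. (C * onorm ((*v) E) * r^k) * r^j) sums ((C * onorm ((*v) E) * r^k) * (1 / (1 - r)))"
    by (rule sums_mult)
  then show ?thesis by (simp add: gain_def power_add mult_ac)
qed

lemma norm_series_term_le: "norm (matpow At j *v (E *v v)) \<le> gain j * norm v"
proof -
  have "norm (matpow At j *v (E *v v)) \<le> C * r^j * norm (E *v v)" by (rule matpow_bound)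
  also have "\<dots> \<le> C * r^j * (onorm ((*v) E) * norm v)"
    using C_nonneg rate_pos by (intro mult_left_mono onorm[OF matrix_vector_mul_bounded_linear]) auto
  finally show ?thesis by (simp add: gain_def mult_ac)
qed

lemma matpow_tendsto_0: "(\<lambda>k. matpow At k *v x) \<longlonglongrightarrow> 0"
proof (rule Lim_null_comparison)
  show "\<forall>\<^sub>F k in sequentially. norm (matpow At k *v x) \<le> C * r^k * norm x"
    using matpow_bound by simp
  have "(\<lambda>k. r^k) \<longlonglongrightarrow> 0" using rate_pos rate_less_1 by (intro LIMSEQ_power_zero) simp
  then show "(\<lambda>k. C * r^k * norm x) \<longlonglongrightarrow> 0"
    by (auto intro: tendsto_mult_left_zero tendsto_mult_right_zero)
qed

lemma invertible_id_minus: "invertible (mat 1 - At)"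
  by (rule invertible_id_minus_if_matpow_tendsto_0[OF matpow_tendsto_0])

lemma measurable_path_component[measurable]: "(\<lambda>\<omega>. \<omega> j) \<in> measurable borel_paths borel"
  by (rule measurable_component_singleton) simp

lemma measurable_noise_series[measurable]: "noise_series \<in> borel_measurable borel_paths"
  unfolding noise_series_def suminf_eq_lim by measurable

lemma measurable_limit_state[measurable]: "limit_state \<in> borel_measurable borel_paths"
  unfolding limit_state_def by measurable

lemma nn_integral_power2_tail_le:
  "(\<integral>\<^sup>+ \<omega>. (\<Sum>j. ennreal (gain (j + k) * norm (\<omega> (j + k) - w_mean)))\<^sup>2 \<partial>path_law)
     \<le> (ennreal (C * onorm ((*v) E) * r^k / (1 - r)))\<^sup>2 * w_var"
proof -
  have "(\<integral>\<^sup>+ \<omega>. (\<Sum>j. ennreal (gain (j + k) * norm (\<omega> (j + k) - w_mean)))\<^sup>2 \<partial>path_law)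
     \<le> (\<Sum>j. ennreal (gain (j + k)))\<^sup>2 * w_var"
  proof (rule nn_integral_power2_suminf_le)
    show "(\<lambda>\<omega>. norm (\<omega> (j + k) - w_mean)) \<in> borel_measurable path_law" for j
      by (simp add: measurable_cong_sets[OF sets_path_law refl])
    show "(\<integral>\<^sup>+ \<omega>. ennreal ((norm (\<omega> (j + k) - w_mean))\<^sup>2) \<partial>path_law) \<le> w_var" for j
      by (subst nn_integral_path_law) (simp_all add: w_path_def w_var_eq)
  qed (auto simp: gain_nonneg)
  also have "(\<Sum>j. ennreal (gain (j + k))) = ennreal (C * onorm ((*v) E) * r^k / (1 - r))"
    using gain_shift_sums[of k] gain_nonneg by (simp add: sums_iff suminf_ennreal2)
  finally show ?thesis .
qed

lemma AE_summable_path: "AE \<omega> in path_law. summable_path \<omega>"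
proof -
  have "(\<integral>\<^sup>+ \<omega>. (\<Sum>j. ennreal (gain j * norm (\<omega> j - w_mean)))\<^sup>2 \<partial>path_law) < \<infinity>"
    using nn_integral_power2_tail_le[of 0] w_var_finite
    by (auto simp: ennreal_mult_less_top power_less_top_ennreal intro: le_less_trans)
  then have "AE \<omega> in path_law. (\<Sum>j. ennreal (gain j * norm (\<omega> j - w_mean)))\<^sup>2 \<noteq> \<infinity>"
    by (intro nn_integral_PInf_AE) (simp_all add: measurable_cong_sets[OF sets_path_law refl])
  then show ?thesis
  proof (rule AE_mp, intro AE_I2 impI)
    fix \<omega> assume "(\<Sum>j. ennreal (gain j * norm (\<omega> j - w_mean)))\<^sup>2 \<noteq> \<infinity>"
    then have "(\<Sum>j. ennreal (gain j * norm (\<omega> j - w_mean))) \<noteq> \<infinity>"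
      by (auto simp: power2_eq_square ennreal_mult_eq_top_iff)
    then show "summable_path \<omega>" unfolding summable_path_def
      by (intro summable_suminf_not_top) (auto simp: gain_nonneg)
  qed
qed

lemma AE_summable_w_path: "AE \<omega> in M. summable_path (w_path \<omega>)"
  by (rule AE_distrD[OF measurable_w_path_path_law]) (unfold distr_w_path_path_law, rule AE_summable_path)

lemma summable_norm_series_term:
  assumes "summable_path \<omega>"
  shows "summable (\<lambda>j. norm (matpow At j *v (E *v (\<omega> j - w_mean))))"
  using assms unfolding summable_path_def
  by (rule summable_comparison_test'[where N=0]) (simp add: norm_series_term_le)

lemma summable_tail_sum:
  assumes "summable_path \<omega>"
  shows "summable (\<lambda>j. gain (j + k) * norm (\<omega> (j + k) - w_mean))"
  using assms summable_iff_shift[of "\<lambda>j. gain j * norm (\<omega> j - w_mean)" k] unfolding summable_path_def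
  by simp

lemma tail_sum_nonneg: "summable_path \<omega> \<Longrightarrow> 0 \<le> tail_sum k \<omega>"
  unfolding tail_sum_def by (intro suminf_nonneg summable_tail_sum) (simp_all add: gain_nonneg)

lemma norm_noise_series_tail_le:
  assumes "summable_path \<omega>"
  shows "norm (noise_series \<omega> - (\<Sum>j<k. matpow At j *v (E *v (\<omega> j - w_mean)))) \<le> tail_sum k \<omega>"
proof -
  let ?g = "\<lambda>j. matpow At j *v (E *v (\<omega> j - w_mean))"
  have sn: "summable (\<lambda>j. norm (?g j))" by (rule summable_norm_series_term[OF assms])
  then have s: "summable ?g" by (rule summable_norm_cancel)
  have sk: "summable (\<lambda>j. norm (?g (j + k)))"
    using sn summable_iff_shift[of "\<lambda>j. norm (?g j)" k] by simp
  have "noise_series \<omega> - (\<Sum>j<k. ?g j) = (\<Sum>j. ?g (j + k))"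
    unfolding noise_series_def using suminf_split_initial_segment[OF s, of k] by simp
  also have "norm \<dots> \<le> (\<Sum>j. norm (?g (j + k)))" by (rule summable_norm[OF sk])
  also have "\<dots> \<le> tail_sum k \<omega>"
    unfolding tail_sum_def
    by (rule suminf_le[OF _ sk summable_tail_sum[OF assms]]) (simp add: norm_series_term_le)
  finally show ?thesis .
qed

lemma equilibrium_fixpoint: "At *v equilibrium + Ft *v w_mean = equilibrium"
proof -
  have "(mat 1 - At) *v equilibrium = Ft *v w_mean"
    unfolding equilibrium_def
    by (simp add: matrix_vector_mul_assoc matrix_mul_assoc matrix_inv_right[OF invertible_id_minus])
  then show ?thesis by (simp add: matrix_vector_mult_diff_rdistrib algebra_simps)
qed

lemma limit_state_shift:
  assumes "summable_path \<omega>"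
  shows "limit_state (case_nat w \<omega>) = At *v limit_state \<omega> + Ft *v w_mean + E *v (w - w_mean)"
proof -
  let ?h = "\<lambda>j. matpow At j *v (E *v (\<omega> j - w_mean))"
  let ?g = "\<lambda>j. matpow At j *v (E *v (case_nat w \<omega> j - w_mean))"
  have sh: "summable ?h" using summable_norm_series_term[OF assms] by (rule summable_norm_cancel)
  have bl: "bounded_linear ((*v) At)" by simp
  have gs: "(\<lambda>j. ?g (Suc j)) = (\<lambda>j. At *v ?h j)"
    by (simp add: matrix_vector_mul_assoc matrix_mul_assoc)
  have "summable (\<lambda>j. ?g (Suc j))" unfolding gs by (rule bounded_linear.summable[OF bl sh])
  then have sg: "summable ?g" using summable_Suc_iff[of ?g] by blast
  have "noise_series (case_nat w \<omega>) = ?g 0 + (\<Sum>j. ?g (Suc j))"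
    unfolding noise_series_def using suminf_split_head[OF sg] by simp
  also have "(\<Sum>j. ?g (Suc j)) = At *v noise_series \<omega>"
    unfolding gs noise_series_def by (rule bounded_linear.suminf[OF bl sh, symmetric])
  finally have "noise_series (case_nat w \<omega>) = E *v (w - w_mean) + At *v noise_series \<omega>" by simp
  then have "limit_state (case_nat w \<omega>) = (At *v equilibrium + Ft *v w_mean) + (E *v (w - w_mean) + At *v noise_series \<omega>)"
    unfolding limit_state_def equilibrium_fixpoint by simp
  then show ?thesis
    unfolding limit_state_def by (simp only: matrix_vector_right_distrib add_ac)
qed

text \<open>Using the noise values in reverse order turns the k-step state into a partial sum of
  the series defining limit_state.\<close>

definition "state k x \<omega> = matpow At k *v x
    + (\<Sum>i<k. matpow At i *v (Ft *v w_mean + E *v (\<omega> (k - 1 - i) - w_mean)))"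
definition "reversed_state k x \<omega> = matpow At k *v x
    + (\<Sum>i<k. matpow At i *v (Ft *v w_mean + E *v (\<omega> i - w_mean)))"
definition "time_reversal k i = (if i < k then k - 1 - i else (i::nat))"

lemma state_0: "state 0 x \<omega> = x"
  by (simp add: state_def)

lemma state_Suc: "state (Suc k) x \<omega> = At *v state k x \<omega> + Ft *v w_mean + E *v (\<omega> k - w_mean)"
proof -
  let ?v = "\<lambda>i. Ft *v w_mean + E *v (\<omega> (k - 1 - i) - w_mean)"
  have "(\<Sum>i<Suc k. matpow At i *v (Ft *v w_mean + E *v (\<omega> (Suc k - 1 - i) - w_mean)))
      = (Ft *v w_mean + E *v (\<omega> k - w_mean)) + (\<Sum>i<k. matpow At (Suc i) *v ?v i)"
    by (subst sum.lessThan_Suc_shift) simp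
  also have "(\<Sum>i<k. matpow At (Suc i) *v ?v i) = At *v (\<Sum>i<k. matpow At i *v ?v i)"
    by (simp add: vec.sum matrix_vector_mul_assoc)
  finally show ?thesis
    by (simp add: state_def matrix_vector_right_distrib matrix_vector_mul_assoc add_ac)
qed

lemma inj_time_reversal: "inj (time_reversal k)"
  unfolding inj_def time_reversal_def by (auto split: if_splits)

lemma state_time_reversal: "state k x (\<omega> \<circ> time_reversal k) = reversed_state k x \<omega>"
proof -
  have "(\<Sum>i<k. matpow At i *v (Ft *v w_mean + E *v ((\<omega> \<circ> time_reversal k) (k - 1 - i) - w_mean)))
      = (\<Sum>i<k. matpow At i *v (Ft *v w_mean + E *v (\<omega> i - w_mean)))"
    by (rule sum.cong) (auto simp: time_reversal_def)
  then show ?thesis by (simp add: state_def reversed_state_def)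
qed

lemma reversed_state_eq: "reversed_state k x \<omega> = matpow At k *v x
    + resolvent *v (Ft *v w_mean - matpow At k *v (Ft *v w_mean))
    + (\<Sum>i<k. matpow At i *v (E *v (\<omega> i - w_mean)))"
proof -
  have "(\<Sum>i<k. matpow At i *v v) = resolvent *v ((mat 1 - At) *v (\<Sum>i<k. matpow At i *v v))" for v
    by (simp add: matrix_vector_mul_assoc matrix_inv_left[OF invertible_id_minus])
  then have "(\<Sum>i<k. matpow At i *v v) = resolvent *v (v - matpow At k *v v)" for v
    by (simp only: id_minus_mult_geometric_sum)
  then show ?thesis
    unfolding reversed_state_def by (simp add: matrix_vector_right_distrib sum.distrib)
qed

lemma equilibrium_eq: "equilibrium = resolvent *v (Ft *v w_mean)"
  unfolding equilibrium_def by (simp add: matrix_vector_mul_assoc)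

lemma reversed_state_tendsto:
  assumes "summable_path \<omega>"
  shows "(\<lambda>k. reversed_state k x \<omega>) \<longlonglongrightarrow> limit_state \<omega>"
proof -
  have "(\<lambda>k. Ft *v w_mean - matpow At k *v (Ft *v w_mean)) \<longlonglongrightarrow> Ft *v w_mean - 0"
    by (intro tendsto_diff tendsto_const matpow_tendsto_0)
  then have "(\<lambda>k. resolvent *v (Ft *v w_mean - matpow At k *v (Ft *v w_mean))) \<longlonglongrightarrow> equilibrium"
    unfolding equilibrium_eq using bounded_linear.tendsto[OF matrix_vector_mul_bounded_linear] by simp
  moreover have "(\<lambda>k. \<Sum>i<k. matpow At i *v (E *v (\<omega> i - w_mean))) \<longlonglongrightarrow> noise_series \<omega>"
    unfolding noise_series_def
    by (rule summable_LIMSEQ[OF summable_norm_cancel[OF summable_norm_series_term[OF assms]]])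
  ultimately have "(\<lambda>k. reversed_state k x \<omega>) \<longlonglongrightarrow> 0 + equilibrium + noise_series \<omega>"
    unfolding reversed_state_eq by (intro tendsto_add matpow_tendsto_0)
  then show ?thesis unfolding limit_state_def by simp
qed

lemma power2_dist_reversed_state_le:
  assumes "summable_path \<omega>"
  shows "(dist (reversed_state k x \<omega>) (limit_state \<omega>))\<^sup>2
    \<le> (r^k)\<^sup>2 * (3 * C\<^sup>2 * (norm x)\<^sup>2 + 3 * (onorm ((*v) resolvent) * C * norm (Ft *v w_mean))\<^sup>2)
      + 3 * (tail_sum k \<omega>)\<^sup>2"
proof -
  let ?Q = "onorm ((*v) resolvent) * C * norm (Ft *v w_mean)"
  have diff: "reversed_state k x \<omega> - limit_state \<omega> = matpow At k *v x - resolvent *v (matpow At k *v (Ft *v w_mean))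
      - (noise_series \<omega> - (\<Sum>i<k. matpow At i *v (E *v (\<omega> i - w_mean))))"
    unfolding reversed_state_eq limit_state_def equilibrium_eq
    by (simp add: matrix_vector_mult_diff_distrib algebra_simps)
  have "dist (reversed_state k x \<omega>) (limit_state \<omega>) \<le> norm (matpow At k *v x)
      + norm (resolvent *v (matpow At k *v (Ft *v w_mean)))
      + norm (noise_series \<omega> - (\<Sum>i<k. matpow At i *v (E *v (\<omega> i - w_mean))))"
    unfolding dist_norm diff by (rule order_trans[OF norm_triangle_ineq4 add_right_mono[OF norm_triangle_ineq4]])
  also have "\<dots> \<le> C * r^k * norm x + ?Q * r^k + tail_sum k \<omega>"
  proof (intro add_mono matpow_bound norm_noise_series_tail_le[OF assms])
    show "norm (resolvent *v (matpow At k *v (Ft *v w_mean))) \<le> ?Q * r^k"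
      using order_trans[OF onorm[OF matrix_vector_mul_bounded_linear]
          mult_left_mono[OF matpow_bound onorm_pos_le[OF matrix_vector_mul_bounded_linear]],
          of resolvent k "Ft *v w_mean"]
      by (simp add: mult_ac)
  qed
  finally have "(dist (reversed_state k x \<omega>) (limit_state \<omega>))\<^sup>2
      \<le> 3 * (C * r^k * norm x)\<^sup>2 + 3 * (?Q * r^k)\<^sup>2 + 3 * (tail_sum k \<omega>)\<^sup>2"
    by (rule power2_le_3_sum_power2[OF zero_le_dist])
  then show ?thesis
    by (simp add: power_mult_distrib distrib_left mult_ac)
qed

lemma nn_integral_power2_tail_sum_le:
  "(\<integral>\<^sup>+ \<omega>. ennreal ((tail_sum k \<omega>)\<^sup>2) \<partial>path_law)
     \<le> ennreal ((r^k)\<^sup>2) * ennreal ((C * onorm ((*v) E) / (1 - r))\<^sup>2) * w_var"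
proof -
  have "(\<integral>\<^sup>+ \<omega>. ennreal ((tail_sum k \<omega>)\<^sup>2) \<partial>path_law)
      = (\<integral>\<^sup>+ \<omega>. (\<Sum>j. ennreal (gain (j + k) * norm (\<omega> (j + k) - w_mean)))\<^sup>2 \<partial>path_law)"
  proof (rule nn_integral_cong_AE)
    show "AE \<omega> in path_law. ennreal ((tail_sum k \<omega>)\<^sup>2)
        = (\<Sum>j. ennreal (gain (j + k) * norm (\<omega> (j + k) - w_mean)))\<^sup>2"
      using AE_summable_path
      by eventually_elim
        (simp add: tail_sum_def suminf_ennreal2 summable_tail_sum gain_nonneg ennreal_power
          tail_sum_nonneg[unfolded tail_sum_def])
  qed
  also have "\<dots> \<le> (ennreal (C * onorm ((*v) E) * r^k / (1 - r)))\<^sup>2 * w_var"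
    by (rule nn_integral_power2_tail_le)
  also have "(ennreal (C * onorm ((*v) E) * r^k / (1 - r)))\<^sup>2
      = ennreal ((r^k)\<^sup>2) * ennreal ((C * onorm ((*v) E) / (1 - r))\<^sup>2)"
  proof -
    have "(C * onorm ((*v) E) * r^k / (1 - r))\<^sup>2 = (r^k)\<^sup>2 * (C * onorm ((*v) E) / (1 - r))\<^sup>2"
      by (simp add: power_mult_distrib power_divide)
    then show ?thesis
      using C_nonneg rate_pos rate_less_1 onorm_pos_le[OF matrix_vector_mul_bounded_linear, of E]
      by (simp add: ennreal_power ennreal_mult[symmetric])
  qed
  finally show ?thesis .
qed

lemma ennreal_power2_dist_reversed_state_le:
  assumes "summable_path \<omega>"
  shows "ennreal ((dist (reversed_state k x \<omega>) (limit_state \<omega>))\<^sup>2)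
    \<le> ennreal ((r^k)\<^sup>2) * (ennreal (3 * C\<^sup>2) * ennreal ((norm x)\<^sup>2)
        + ennreal (3 * (onorm ((*v) resolvent) * C * norm (Ft *v w_mean))\<^sup>2))
      + 3 * ennreal ((tail_sum k \<omega>)\<^sup>2)"
proof -
  have "ennreal ((r^k)\<^sup>2) * (ennreal (3 * C\<^sup>2) * ennreal ((norm x)\<^sup>2)
        + ennreal (3 * (onorm ((*v) resolvent) * C * norm (Ft *v w_mean))\<^sup>2)) + 3 * ennreal ((tail_sum k \<omega>)\<^sup>2)
      = ennreal ((r^k)\<^sup>2 * (3 * C\<^sup>2 * (norm x)\<^sup>2 + 3 * (onorm ((*v) resolvent) * C * norm (Ft *v w_mean))\<^sup>2)
        + 3 * (tail_sum k \<omega>)\<^sup>2)"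
    by (simp add: ennreal_plus ennreal_mult)
  with power2_dist_reversed_state_le[OF assms] show ?thesis
    by (simp add: ennreal_leI del: ennreal_plus)
qed

lemma nn_integral_power2_dist_reversed_state_le:
  assumes "prob_space \<mu>0" and sets_\<mu>0: "sets \<mu>0 = sets borel"
  shows "(\<integral>\<^sup>+ p. ennreal ((dist (reversed_state k (fst p) (snd p)) (limit_state (snd p)))\<^sup>2) \<partial>(\<mu>0 \<Otimes>\<^sub>M path_law))
    \<le> ennreal ((r^k)\<^sup>2) * (ennreal (3 * C\<^sup>2) * (\<integral>\<^sup>+ x. ennreal ((norm x)\<^sup>2) \<partial>\<mu>0)
      + ennreal (3 * (onorm ((*v) resolvent) * C * norm (Ft *v w_mean))\<^sup>2)
      + 3 * ennreal ((C * onorm ((*v) E) / (1 - r))\<^sup>2) * w_var)"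
    (is "_ \<le> ennreal ((r^k)\<^sup>2) * (ennreal ?c1 * ?I0 + ennreal ?c2 + 3 * ennreal ?c3 * w_var)")
proof -
  interpret \<mu>0: prob_space \<mu>0 by fact
  interpret path_law: prob_space path_law by (rule prob_space_path_law)
  interpret pair_prob_space \<mu>0 path_law ..
  have sets_pair: "sets (\<mu>0 \<Otimes>\<^sub>M path_law) = sets (borel \<Otimes>\<^sub>M borel_paths)"
    using sets_\<mu>0 sets_path_law by (rule sets_pair_measure_cong)
  have [measurable]: "tail_sum k \<in> borel_measurable path_law"
    unfolding tail_sum_def suminf_eq_lim by (simp add: measurable_cong_sets[OF sets_path_law refl])
  have distr_snd: "distr (\<mu>0 \<Otimes>\<^sub>M path_law) path_law snd = path_law"
    by (rule distr_pair_snd[OF \<mu>0.prob_space_axioms path_law.sigma_finite_measure_axioms])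
  have "AE p in \<mu>0 \<Otimes>\<^sub>M path_law. summable_path (snd p)"
    by (rule AE_distrD[OF measurable_snd]) (unfold distr_snd, rule AE_summable_path)
  moreover note ennreal_power2_dist_reversed_state_le
  ultimately have "(\<integral>\<^sup>+ p. ennreal ((dist (reversed_state k (fst p) (snd p)) (limit_state (snd p)))\<^sup>2) \<partial>(\<mu>0 \<Otimes>\<^sub>M path_law))
      \<le> (\<integral>\<^sup>+ p. ennreal ((r^k)\<^sup>2) * (ennreal ?c1 * ennreal ((norm (fst p))\<^sup>2) + ennreal ?c2)
            + 3 * ennreal ((tail_sum k (snd p))\<^sup>2) \<partial>(\<mu>0 \<Otimes>\<^sub>M path_law))"
    by (intro nn_integral_mono_AE) (auto elim!: AE_mp)
  also have "\<dots> = ennreal ((r^k)\<^sup>2) * (ennreal ?c1 * (\<integral>\<^sup>+ p. ennreal ((norm (fst p))\<^sup>2) \<partial>(\<mu>0 \<Otimes>\<^sub>M path_law))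
      + ennreal ?c2) + 3 * (\<integral>\<^sup>+ p. ennreal ((tail_sum k (snd p))\<^sup>2) \<partial>(\<mu>0 \<Otimes>\<^sub>M path_law))"
    using emeasure_space_1
    by (simp add: nn_integral_add nn_integral_cmult measurable_cong_sets[OF sets_pair refl])
  also have "(\<integral>\<^sup>+ p. ennreal ((norm (fst p))\<^sup>2) \<partial>(\<mu>0 \<Otimes>\<^sub>M path_law)) = ?I0"
    by (subst nn_integral_distr[OF measurable_fst, symmetric])
      (simp_all add: measurable_cong_sets[OF sets_\<mu>0 refl] path_law.distr_pair_fst)
  also have "(\<integral>\<^sup>+ p. ennreal ((tail_sum k (snd p))\<^sup>2) \<partial>(\<mu>0 \<Otimes>\<^sub>M path_law))
      = (\<integral>\<^sup>+ \<omega>. ennreal ((tail_sum k \<omega>)\<^sup>2) \<partial>path_law)"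
    by (subst nn_integral_distr[OF measurable_snd, symmetric])
      (simp_all add: distr_snd)
  also have "3 * (\<integral>\<^sup>+ \<omega>. ennreal ((tail_sum k \<omega>)\<^sup>2) \<partial>path_law) \<le> 3 * (ennreal ((r^k)\<^sup>2) * ennreal ?c3 * w_var)"
    by (intro mult_left_mono nn_integral_power2_tail_sum_le) simp
  finally show ?thesis
    by (simp add: distrib_left mult_ac add_left_mono)
qed

lemma reversed_state_L2_tendsto:
  assumes "prob_space \<mu>0" "sets \<mu>0 = sets borel"
    and second_moment: "(\<integral>\<^sup>+ x. ennreal ((norm x)\<^sup>2) \<partial>\<mu>0) < \<infinity>"
  shows "(\<lambda>k. \<integral>\<^sup>+ p. ennreal ((dist (reversed_state k (fst p) (snd p)) (limit_state (snd p)))\<^sup>2)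
      \<partial>(\<mu>0 \<Otimes>\<^sub>M path_law)) \<longlonglongrightarrow> 0"
proof (rule tendsto_sandwich[OF _ _ tendsto_const])
  let ?K = "ennreal (3 * C\<^sup>2) * (\<integral>\<^sup>+ x. ennreal ((norm x)\<^sup>2) \<partial>\<mu>0)
      + ennreal (3 * (onorm ((*v) resolvent) * C * norm (Ft *v w_mean))\<^sup>2)
      + 3 * ennreal ((C * onorm ((*v) E) / (1 - r))\<^sup>2) * w_var"
  show "\<forall>\<^sub>F k in sequentially. (\<integral>\<^sup>+ p. ennreal ((dist (reversed_state k (fst p) (snd p)) (limit_state (snd p)))\<^sup>2)
      \<partial>(\<mu>0 \<Otimes>\<^sub>M path_law)) \<le> ennreal ((r^k)\<^sup>2) * ?K"
    using nn_integral_power2_dist_reversed_state_le[OF assms(1,2)] by simp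
  have "(\<lambda>k. (r^k)\<^sup>2) \<longlonglongrightarrow> 0\<^sup>2"
    using rate_pos rate_less_1 by (intro tendsto_power LIMSEQ_power_zero) simp
  then have "(\<lambda>k. ennreal ((r^k)\<^sup>2) * ?K) \<longlonglongrightarrow> ennreal 0 * ?K"
    using second_moment w_var_finite
    by (intro tendsto_mult_ennreal tendsto_ennrealI tendsto_const)
      (auto simp: ennreal_mult_eq_top_iff)
  then show "(\<lambda>k. ennreal ((r^k)\<^sup>2) * ?K) \<longlonglongrightarrow> 0" by simp
qed simp

lemma measurable_state[measurable]: "(\<lambda>p. state k (fst p) (snd p)) \<in> borel_measurable (borel \<Otimes>\<^sub>M borel_paths)"
  unfolding state_def by measurable

lemma measurable_reversed_state[measurable]:
  "(\<lambda>p. reversed_state k (fst p) (snd p)) \<in> borel_measurable (borel \<Otimes>\<^sub>M borel_paths)"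
  unfolding reversed_state_def by measurable

text \<open>Reversing the first k noise values preserves the law of the noise path.\<close>

lemma distr_state:
  fixes X0 :: "'a \<Rightarrow> real^'nx" and h :: "real^'nx \<Rightarrow> 'c::euclidean_space"
  assumes [measurable]: "X0 \<in> borel_measurable M" "h \<in> borel_measurable borel"
    and indep: "indep_set {X0 -` S \<inter> space M | S. S \<in> sets borel} {w_path -` S \<inter> space M | S. S \<in> sets borel_paths}"
  shows "distr M borel (\<lambda>\<omega>. h (state k (X0 \<omega>) (w_path \<omega>)))
       = distr (distr M borel X0 \<Otimes>\<^sub>M path_law) borel (\<lambda>p. h (reversed_state k (fst p) (snd p)))"
proof -
  define \<mu>0 where "\<mu>0 = distr M borel X0"
  interpret \<mu>0: prob_space \<mu>0 unfolding \<mu>0_def by (rule prob_space_distr) simp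
  interpret path_law: prob_space path_law by (rule prob_space_path_law)
  have sets_pair: "sets (\<mu>0 \<Otimes>\<^sub>M path_law) = sets (borel \<Otimes>\<^sub>M borel_paths)"
    by (rule sets_pair_measure_cong) (simp_all add: \<mu>0_def sets_path_law)
  define reverse where "reverse = (\<lambda>(x::real^'nx, \<omega>::nat \<Rightarrow> real^'nw). (x, \<omega> \<circ> time_reversal k))"
  have [measurable]: "reverse \<in> measurable (borel \<Otimes>\<^sub>M borel_paths) (borel \<Otimes>\<^sub>M borel_paths)"
    unfolding reverse_def by measurable
  have h_state: "(\<lambda>p. h (state k (fst p) (snd p))) \<in> borel_measurable (\<mu>0 \<Otimes>\<^sub>M path_law)"
    unfolding measurable_cong_sets[OF sets_pair refl] by measurable
  have joint: "distr M (borel \<Otimes>\<^sub>M borel_paths) (\<lambda>\<omega>. (X0 \<omega>, w_path \<omega>)) = \<mu>0 \<Otimes>\<^sub>M path_law"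
    using distr_pair_eq_pair_measure_if_indep_set[OF _ _ indep] by (simp add: \<mu>0_def distr_w_path)
  have "distr \<mu>0 \<mu>0 (\<lambda>x. x) \<Otimes>\<^sub>M distr path_law path_law (\<lambda>\<omega>. \<omega> \<circ> time_reversal k)
      = distr (\<mu>0 \<Otimes>\<^sub>M path_law) (\<mu>0 \<Otimes>\<^sub>M path_law) reverse"
    unfolding reverse_def
    by (rule pair_measure_distr)
      (auto simp: measurable_cong_sets[OF sets_path_law sets_path_law] distr_path_law_reindex[OF inj_time_reversal]
        intro: path_law.sigma_finite_measure_axioms)
  then have reverse_invariant: "distr (\<mu>0 \<Otimes>\<^sub>M path_law) (\<mu>0 \<Otimes>\<^sub>M path_law) reverse = \<mu>0 \<Otimes>\<^sub>M path_law"
    by (simp add: distr_path_law_reindex[OF inj_time_reversal])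
  have "distr M borel (\<lambda>\<omega>. h (state k (X0 \<omega>) (w_path \<omega>)))
      = distr (\<mu>0 \<Otimes>\<^sub>M path_law) borel (\<lambda>p. h (state k (fst p) (snd p)))"
    by (subst joint[symmetric], subst distr_distr) (simp_all add: comp_def h_state)
  also have "\<dots> = distr (\<mu>0 \<Otimes>\<^sub>M path_law) borel (\<lambda>p. h (state k (fst (reverse p)) (snd (reverse p))))"
    by (subst (1) reverse_invariant[symmetric], subst distr_distr)
      (simp_all add: comp_def h_state measurable_cong_sets[OF sets_pair sets_pair])
  also have "\<dots> = distr (\<mu>0 \<Otimes>\<^sub>M path_law) borel (\<lambda>p. h (reversed_state k (fst p) (snd p)))"
    by (simp add: reverse_def case_prod_beta state_time_reversal)
  finally show ?thesis unfolding \<mu>0_def .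
qed

lemma distr_limit_state_w_path:
  fixes h :: "real^'nx \<Rightarrow> 'c::euclidean_space"
  assumes [measurable]: "h \<in> borel_measurable borel"
  shows "distr M borel (\<lambda>\<omega>. h (limit_state (w_path \<omega>))) = distr path_law borel (\<lambda>\<omega>. h (limit_state \<omega>))"
  by (subst distr_w_path_path_law[symmetric], subst distr_distr)
    (simp_all add: measurable_w_path_path_law comp_def)

lemma distr_limit_state:
  fixes h :: "real^'nx \<Rightarrow> 'c::euclidean_space"
  assumes "prob_space \<mu>0" and [measurable]: "h \<in> borel_measurable borel"
  shows "distr M borel (\<lambda>\<omega>. h (limit_state (w_path \<omega>))) = distr (\<mu>0 \<Otimes>\<^sub>M path_law) borel (\<lambda>p. h (limit_state (snd p)))"
proof -
  interpret path_law: prob_space path_law by (rule prob_space_path_law)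
  show ?thesis
    unfolding distr_limit_state_w_path[OF assms(2)]
    by (subst distr_pair_snd[OF assms(1) path_law.sigma_finite_measure_axioms, symmetric],
        subst distr_distr) (simp_all add: comp_def)
qed

lemma reversed_state_laws_converge:
  fixes h :: "real^'nx \<Rightarrow> 'c::euclidean_space"
  assumes \<mu>0: "prob_space \<mu>0" and sets_\<mu>0: "sets \<mu>0 = sets borel"
    and second_moment: "(\<integral>\<^sup>+ x. ennreal ((norm x)\<^sup>2) \<partial>\<mu>0) < \<infinity>"
    and h: "L-lipschitz_on UNIV h"
  defines "Y \<equiv> \<lambda>k p. h (reversed_state k (fst p) (snd p))" and "Z \<equiv> \<lambda>p. h (limit_state (snd p))"
  shows "weak_conv_law (\<lambda>k. distr (\<mu>0 \<Otimes>\<^sub>M path_law) borel (Y k)) (distr (\<mu>0 \<Otimes>\<^sub>M path_law) borel Z)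
       \<and> W2_conv_law (\<lambda>k. distr (\<mu>0 \<Otimes>\<^sub>M path_law) borel (Y k)) (distr (\<mu>0 \<Otimes>\<^sub>M path_law) borel Z)"
proof -
  interpret path_law: prob_space path_law by (rule prob_space_path_law)
  have h_cont: "isCont h x" for x
    using lipschitz_on_continuous_on[OF h] by (simp add: continuous_on_eq_continuous_at)
  have [measurable]: "h \<in> borel_measurable borel"
    using lipschitz_on_continuous_on[OF h] by (rule borel_measurable_continuous_onI)
  have sets_pair: "sets (\<mu>0 \<Otimes>\<^sub>M path_law) = sets (borel \<Otimes>\<^sub>M borel_paths)"
    by (rule sets_pair_measure_cong) (simp_all add: sets_\<mu>0 sets_path_law)
  have Y_measurable: "Y k \<in> borel_measurable (\<mu>0 \<Otimes>\<^sub>M path_law)" for k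
    unfolding measurable_cong_sets[OF sets_pair refl] Y_def by measurable
  have Z_measurable: "Z \<in> borel_measurable (\<mu>0 \<Otimes>\<^sub>M path_law)"
    unfolding measurable_cong_sets[OF sets_pair refl] Z_def by measurable
  have distr_snd: "distr (\<mu>0 \<Otimes>\<^sub>M path_law) path_law snd = path_law"
    by (rule distr_pair_snd[OF \<mu>0 path_law.sigma_finite_measure_axioms])
  have "AE p in \<mu>0 \<Otimes>\<^sub>M path_law. summable_path (snd p)"
    by (rule AE_distrD[OF measurable_snd]) (unfold distr_snd, rule AE_summable_path)
  then have AE_tendsto: "AE p in \<mu>0 \<Otimes>\<^sub>M path_law. (\<lambda>k. Y k p) \<longlonglongrightarrow> Z p"
    unfolding Y_def Z_def
    by eventually_elim (rule isCont_tendsto_compose[OF h_cont reversed_state_tendsto])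
  have L2_tendsto: "(\<lambda>k. \<integral>\<^sup>+ p. ennreal ((dist (Y k p) (Z p))\<^sup>2) \<partial>(\<mu>0 \<Otimes>\<^sub>M path_law)) \<longlonglongrightarrow> 0"
    unfolding Y_def Z_def
    by (rule nn_integral_dist_power2_lipschitz_tendsto[OF h _ _ reversed_state_L2_tendsto[OF \<mu>0 sets_\<mu>0 second_moment]])
      (unfold measurable_cong_sets[OF sets_pair refl], measurable)
  have pair: "prob_space (\<mu>0 \<Otimes>\<^sub>M path_law)"
    by (rule prob_space_pair[OF \<mu>0 prob_space_path_law])
  show ?thesis
    by (rule conjI[OF weak_conv_law_of_AE_tendsto[OF pair Y_measurable Z_measurable AE_tendsto]
          W2_conv_law_of_nn_integral_tendsto[OF pair Y_measurable Z_measurable L2_tendsto]])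
qed

lemma closed_loop_laws_converge:
  fixes X :: "nat \<Rightarrow> 'a \<Rightarrow> real^'nx" and h :: "real^'nx \<Rightarrow> 'c::euclidean_space"
  assumes X0_measurable[measurable]: "X 0 \<in> borel_measurable M"
    and X0_square_integrable: "integrable M (\<lambda>\<omega>. (norm (X 0 \<omega>))\<^sup>2)"
    and indep: "indep_set {X 0 -` S \<inter> space M | S. S \<in> sets borel} {w_path -` S \<inter> space M | S. S \<in> sets borel_paths}"
    and X_Suc: "\<And>k \<omega>. X (Suc k) \<omega> = At *v X k \<omega> + Ft *v w_mean + E *v (W k \<omega> - w_mean)"
    and h: "L-lipschitz_on UNIV h"
  shows "weak_conv_law (\<lambda>k. distr M borel (\<lambda>\<omega>. h (X k \<omega>))) (distr M borel (\<lambda>\<omega>. h (limit_state (w_path \<omega>))))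
       \<and> W2_conv_law (\<lambda>k. distr M borel (\<lambda>\<omega>. h (X k \<omega>))) (distr M borel (\<lambda>\<omega>. h (limit_state (w_path \<omega>))))"
proof -
  define \<mu>0 where "\<mu>0 = distr M borel (X 0)"
  have \<mu>0: "prob_space \<mu>0" unfolding \<mu>0_def by (rule prob_space_distr) simp
  have h_measurable[measurable]: "h \<in> borel_measurable borel"
    using lipschitz_on_continuous_on[OF h] by (rule borel_measurable_continuous_onI)
  have X_eq: "X k \<omega> = state k (X 0 \<omega>) (w_path \<omega>)" for k \<omega>
    by (induction k) (simp_all add: state_0 state_Suc X_Suc w_path_def)
  have "distr M borel (\<lambda>\<omega>. h (X k \<omega>)) = distr M borel (\<lambda>\<omega>. h (state k (X 0 \<omega>) (w_path \<omega>)))" for k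
    by (rule arg_cong[where f="distr M borel"], rule ext, subst X_eq, rule refl)
  also have "\<dots> k = distr (\<mu>0 \<Otimes>\<^sub>M path_law) borel (\<lambda>p. h (reversed_state k (fst p) (snd p)))" for k
    unfolding \<mu>0_def by (rule distr_state[OF X0_measurable _ indep]) simp
  finally have laws: "distr M borel (\<lambda>\<omega>. h (X k \<omega>))
      = distr (\<mu>0 \<Otimes>\<^sub>M path_law) borel (\<lambda>p. h (reversed_state k (fst p) (snd p)))" for k .
  show ?thesis
    unfolding laws distr_limit_state[OF \<mu>0 h_measurable]
    using integrableD(2)[OF X0_square_integrable]
    by (intro reversed_state_laws_converge[OF \<mu>0 _ _ h]) (simp_all add: \<mu>0_def nn_integral_distr less_top)
qed

definition "series_term j \<omega> = matpow At j *v (E *v (W j \<omega> - w_mean))"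

lemma measurable_series_term[measurable]: "series_term j \<in> borel_measurable M"
  unfolding series_term_def by (intro borel_measurable_matrix_vector_mult borel_measurable_diff W_measurable borel_measurable_const)

lemma integrable_power2_series_term_component: "integrable M (\<lambda>\<omega>. ((series_term j \<omega>) $ a)\<^sup>2)"
proof (rule Bochner_Integration.integrable_bound[of _ "\<lambda>\<omega>. (gain j)\<^sup>2 * (norm (W j \<omega> - w_mean))\<^sup>2"])
  show "integrable M (\<lambda>\<omega>. (gain j)\<^sup>2 * (norm (W j \<omega> - w_mean))\<^sup>2)"
    using integrable_power2_norm_centered_W[of j] by (rule integrable_mult_right)
  show "AE \<omega> in M. norm (((series_term j \<omega>) $ a)\<^sup>2) \<le> norm ((gain j)\<^sup>2 * (norm (W j \<omega> - w_mean))\<^sup>2)"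
  proof (rule AE_I2)
    fix \<omega>
    have "\<bar>(series_term j \<omega>) $ a\<bar> \<le> gain j * norm (W j \<omega> - w_mean)"
      using component_le_norm_cart[of "series_term j \<omega>" a] norm_series_term_le[of j "W j \<omega> - w_mean"] unfolding series_term_def by linarith
    then have "\<bar>(series_term j \<omega>) $ a\<bar>\<^sup>2 \<le> (gain j * norm (W j \<omega> - w_mean))\<^sup>2"
      by (intro power_mono) auto
    then show "norm (((series_term j \<omega>) $ a)\<^sup>2) \<le> norm ((gain j)\<^sup>2 * (norm (W j \<omega> - w_mean))\<^sup>2)"
      by (simp add: power_mult_distrib)
  qed
qed measurable

lemma integrable_series_term_product: "integrable M (\<lambda>\<omega>. (series_term j \<omega>) $ a * (series_term l \<omega>) $ c)"
  by (rule integrable_mult_of_power2) (measurable, measurable, rule integrable_power2_series_term_component, rule integrable_power2_series_term_component)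

lemma series_term_eq: "series_term j \<omega> = (matpow At j ** E) *v (W j \<omega> - w_mean)"
  unfolding series_term_def by (simp only: matrix_vector_mul_assoc)

lemma bounded_linear_series_term_component: "bounded_linear (\<lambda>v. ((matpow At j ** E) *v v) $ a)"
  by (rule bounded_linear_compose[OF bounded_linear_vec_nth matrix_vector_mul_bounded_linear])

lemma integrable_series_term_component: "integrable M (\<lambda>\<omega>. (series_term j \<omega>) $ a)"
  unfolding series_term_eq by (rule integrable_bounded_linear[OF bounded_linear_series_term_component integrable_centered_W])

lemma integral_series_term_component: "(\<integral>\<omega>. (series_term j \<omega>) $ a \<partial>M) = 0"
  unfolding series_term_eq
    integral_bounded_linear[OF bounded_linear_series_term_component integrable_centered_W]
  by (simp add: integral_centered_W)

lemma integral_series_term_product_cross: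
  assumes jl: "j \<noteq> l"
  shows "(\<integral>\<omega>. (series_term j \<omega>) $ a * (series_term l \<omega>) $ c \<partial>M) = 0"
proof -
  define g1 where "g1 = (\<lambda>x. ((matpow At j ** E) *v (x - w_mean)) $ a)"
  define g2 where "g2 = (\<lambda>x. ((matpow At l ** E) *v (x - w_mean)) $ c)"
  define Y where "Y = (\<lambda>i. if i = j then g1 else g2)"
  have m1: "g1 \<in> borel_measurable borel" unfolding g1_def by measurable
  have m2: "g2 \<in> borel_measurable borel" unfolding g2_def by measurable
  have Ym: "Y i \<in> measurable borel borel" for i
    unfolding Y_def using m1 m2 by simp
  have ind: "indep_vars (\<lambda>_. borel) (\<lambda>i x. Y i (W i x)) UNIV"
    by (rule indep_vars_compose2[OF W_indep Ym])
  then have ind2: "indep_vars (\<lambda>_. borel) (\<lambda>i x. Y i (W i x)) {j, l}"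
    by (rule indep_vars_subset) simp
  have Yj: "Y j (W j \<omega>) = (series_term j \<omega>) $ a" for \<omega> by (simp add: Y_def g1_def series_term_eq)
  have Yl: "Y l (W l \<omega>) = (series_term l \<omega>) $ c" for \<omega> using jl by (simp add: Y_def g2_def series_term_eq)
  have int: "integrable M (\<lambda>\<omega>. Y i (W i \<omega>))" if "i \<in> {j, l}" for i
    using that Yj Yl integrable_series_term_component by auto
  have "(\<integral>\<omega>. (\<Prod>i\<in>{j, l}. Y i (W i \<omega>)) \<partial>M) = (\<Prod>i\<in>{j, l}. \<integral>\<omega>. Y i (W i \<omega>) \<partial>M)"
    by (rule indep_vars_lebesgue_integral[OF _ ind2 int]) auto
  then show ?thesis using jl by (simp add: Yj Yl integral_series_term_component)
qed

definition "cov_term j = matpow At j ** E ** cov_law w_law ** transpose E ** transpose (matpow At j)"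

lemma cov_term_eq: "cov_term j = (matpow At j ** E) ** cov_law w_law ** transpose (matpow At j ** E)"
  unfolding cov_term_def by (simp add: matrix_transpose_mul matrix_mul_assoc)

lemma integral_series_term_product_diag: "(\<integral>\<omega>. (series_term j \<omega>) $ a * (series_term j \<omega>) $ c \<partial>M) = cov_term j $ a $ c"
proof -
  define P where "P = matpow At j ** E"
  define v where "v = (\<lambda>\<omega>. W j \<omega> - w_mean)"
  have vi: "integrable M (\<lambda>\<omega>. v \<omega> $ p * v \<omega> $ q)" for p q
    unfolding v_def by (rule integrable_mult_of_power2) (measurable, measurable, rule integrable_power2_centered_W_component, rule integrable_power2_centered_W_component)
  have "(\<lambda>\<omega>. (series_term j \<omega>) $ a * (series_term j \<omega>) $ c) = (\<lambda>\<omega>. \<Sum>p\<in>UNIV. \<Sum>q\<in>UNIV. (P $ a $ p * P $ c $ q) * (v \<omega> $ p * v \<omega> $ q))"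
    unfolding series_term_eq P_def[symmetric]
    by (simp add: matrix_vector_mult_def sum_product mult_ac v_def)
  then have "(\<integral>\<omega>. (series_term j \<omega>) $ a * (series_term j \<omega>) $ c \<partial>M)
      = (\<Sum>p\<in>UNIV. \<Sum>q\<in>UNIV. (P $ a $ p * P $ c $ q) * (\<integral>\<omega>. v \<omega> $ p * v \<omega> $ q \<partial>M))"
    using vi by (simp add: Bochner_Integration.integral_sum)
  also have "\<dots> = (\<Sum>p\<in>UNIV. \<Sum>q\<in>UNIV. (P $ a $ p * P $ c $ q) * cov_law w_law $ p $ q)"
    by (simp add: cov_w_law_eq[of _ _ j] v_def)
  also have "\<dots> = (\<Sum>p\<in>UNIV. \<Sum>q\<in>UNIV. P $ a $ p * cov_law w_law $ p $ q * P $ c $ q)"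
    by (simp add: mult_ac)
  also have "\<dots> = (\<Sum>q\<in>UNIV. \<Sum>p\<in>UNIV. P $ a $ p * cov_law w_law $ p $ q * P $ c $ q)"
    by (rule sum.swap)
  also have "\<dots> = cov_term j $ a $ c"
    unfolding cov_term_eq P_def[symmetric]
    by (simp add: matrix_matrix_mult_def transpose_def sum_distrib_right)
  finally show ?thesis .
qed

lemma noise_series_w_path: "noise_series (w_path \<omega>) = (\<Sum>j. series_term j \<omega>)"
  unfolding noise_series_def w_path_def series_term_def ..

lemma integral_partial_sum_product: "(\<integral>\<omega>. (\<Sum>j<n. series_term j \<omega>) $ a * (\<Sum>l<n. series_term l \<omega>) $ c \<partial>M) = (\<Sum>j<n. cov_term j) $ a $ c"
proof -
  have eq: "(\<lambda>\<omega>. (\<Sum>j<n. series_term j \<omega>) $ a * (\<Sum>l<n. series_term l \<omega>) $ c)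
      = (\<lambda>\<omega>. \<Sum>j<n. \<Sum>l<n. (series_term j \<omega>) $ a * (series_term l \<omega>) $ c)"
    by (simp add: sum_component sum_product)
  have "(\<integral>\<omega>. (\<Sum>j<n. \<Sum>l<n. (series_term j \<omega>) $ a * (series_term l \<omega>) $ c) \<partial>M)
      = (\<Sum>j<n. \<Sum>l<n. \<integral>\<omega>. (series_term j \<omega>) $ a * (series_term l \<omega>) $ c \<partial>M)"
    by (simp add: Bochner_Integration.integral_sum Bochner_Integration.integrable_sum integrable_series_term_product)
  also have "\<dots> = (\<Sum>j<n. \<Sum>l<n. if j = l then cov_term j $ a $ c else 0)"
    by (intro sum.cong refl) (auto simp: integral_series_term_product_diag integral_series_term_product_cross)
  also have "\<dots> = (\<Sum>j<n. cov_term j $ a $ c)" by simp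
  also have "\<dots> = (\<Sum>j<n. cov_term j) $ a $ c" by (simp add: sum_component)
  finally show ?thesis unfolding eq .
qed

definition "series_majorant \<omega> = (\<Sum>j. gain j * norm (W j \<omega> - w_mean))\<^sup>2"

lemma measurable_series_majorant[measurable]: "series_majorant \<in> borel_measurable M"
  unfolding series_majorant_def suminf_eq_lim by measurable

lemma integrable_series_majorant: "integrable M series_majorant"
  unfolding integrable_iff_bounded
proof
  show "series_majorant \<in> borel_measurable M" by (rule measurable_series_majorant)
  have "(\<integral>\<^sup>+ \<omega>. ennreal (norm (series_majorant \<omega>)) \<partial>M) = (\<integral>\<^sup>+ \<omega>. (\<Sum>j. ennreal (gain j * norm (W j \<omega> - w_mean)))\<^sup>2 \<partial>M)"
  proof (rule nn_integral_cong_AE)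
    show "AE \<omega> in M. ennreal (norm (series_majorant \<omega>)) = (\<Sum>j. ennreal (gain j * norm (W j \<omega> - w_mean)))\<^sup>2"
      using AE_summable_w_path
    proof (rule AE_mp, intro AE_I2 impI)
      fix \<omega> assume g: "summable_path (w_path \<omega>)"
      then have sm: "summable (\<lambda>j. gain j * norm (W j \<omega> - w_mean))" by (simp add: summable_path_def w_path_def)
      have "(\<Sum>j. ennreal (gain j * norm (W j \<omega> - w_mean))) = ennreal (\<Sum>j. gain j * norm (W j \<omega> - w_mean))"
        by (rule suminf_ennreal2[OF _ sm]) (simp add: gain_nonneg)
      moreover have "0 \<le> (\<Sum>j. gain j * norm (W j \<omega> - w_mean))"
        by (intro suminf_nonneg sm) (simp add: gain_nonneg)
      ultimately show "ennreal (norm (series_majorant \<omega>)) = (\<Sum>j. ennreal (gain j * norm (W j \<omega> - w_mean)))\<^sup>2"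
        by (simp add: series_majorant_def ennreal_power)
    qed
  qed
  also have "\<dots> \<le> (\<Sum>j. ennreal (gain j))\<^sup>2 * w_var"
    by (rule nn_integral_power2_suminf_le) (auto simp: gain_nonneg w_var_eq)
  also have "\<dots> < \<infinity>"
  proof -
    have "(\<Sum>j. ennreal (gain j)) = ennreal (C * onorm ((*v) E) * r^0 / (1 - r))"
      using gain_shift_sums[of 0] gain_nonneg by (simp add: sums_iff suminf_ennreal2)
    then show ?thesis using w_var_finite
      by (simp add: ennreal_mult_less_top power_less_top_ennreal)
  qed
  finally show "(\<integral>\<^sup>+ \<omega>. ennreal (norm (series_majorant \<omega>)) \<partial>M) < \<infinity>" .
qed

lemma abs_partial_sum_product_le:
  assumes "summable_path (w_path \<omega>)"
  shows "\<bar>(\<Sum>j<n. series_term j \<omega>) $ a * (\<Sum>l<n. series_term l \<omega>) $ c\<bar> \<le> series_majorant \<omega>"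
proof -
  have sm: "summable (\<lambda>j. gain j * norm (W j \<omega> - w_mean))"
    using assms by (simp add: summable_path_def w_path_def)
  define T where "T = (\<Sum>j<n. series_term j \<omega>)"
  have "norm T \<le> (\<Sum>j<n. norm (series_term j \<omega>))" unfolding T_def by (rule norm_sum)
  also have "\<dots> \<le> (\<Sum>j<n. gain j * norm (W j \<omega> - w_mean))"
    by (intro sum_mono) (simp add: series_term_def norm_series_term_le)
  also have "\<dots> \<le> (\<Sum>j. gain j * norm (W j \<omega> - w_mean))"
    by (rule sum_le_suminf[OF sm]) (auto simp: gain_nonneg)
  finally have "norm T \<le> (\<Sum>j. gain j * norm (W j \<omega> - w_mean))" .
  then have "norm T * norm T \<le> series_majorant \<omega>"
    unfolding series_majorant_def power2_eq_square by (intro mult_mono) (auto intro: order_trans[OF norm_ge_zero])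
  moreover have "\<bar>T $ a * T $ c\<bar> \<le> norm T * norm T"
    unfolding abs_mult by (intro mult_mono component_le_norm_cart) auto
  ultimately show ?thesis by (simp add: T_def)
qed

lemma partial_cov_tendsto:
  "(\<lambda>n. (\<Sum>j<n. cov_term j) $ a $ c) \<longlonglongrightarrow> (\<integral>\<omega>. noise_series (w_path \<omega>) $ a * noise_series (w_path \<omega>) $ c \<partial>M)"
proof -
  have "(\<lambda>n. \<integral>\<omega>. (\<Sum>j<n. series_term j \<omega>) $ a * (\<Sum>l<n. series_term l \<omega>) $ c \<partial>M)
      \<longlonglongrightarrow> (\<integral>\<omega>. noise_series (w_path \<omega>) $ a * noise_series (w_path \<omega>) $ c \<partial>M)"
  proof (rule integral_dominated_convergence[OF _ _ integrable_series_majorant])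
    show "AE \<omega> in M. (\<lambda>n. (\<Sum>j<n. series_term j \<omega>) $ a * (\<Sum>l<n. series_term l \<omega>) $ c)
        \<longlonglongrightarrow> noise_series (w_path \<omega>) $ a * noise_series (w_path \<omega>) $ c"
      using AE_summable_w_path
    proof eventually_elim
      case (elim \<omega>)
      have "summable (\<lambda>j. series_term j \<omega>)"
        using summable_norm_cancel[OF summable_norm_series_term[OF elim]] by (simp add: w_path_def series_term_def)
      then have "(\<lambda>n. \<Sum>j<n. series_term j \<omega>) \<longlonglongrightarrow> noise_series (w_path \<omega>)"
        unfolding noise_series_w_path by (rule summable_LIMSEQ)
      then show ?case by (intro tendsto_mult tendsto_vec_nth)
    qed
    show "AE \<omega> in M. norm ((\<Sum>j<n. series_term j \<omega>) $ a * (\<Sum>l<n. series_term l \<omega>) $ c) \<le> series_majorant \<omega>" for n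
      using AE_summable_w_path by eventually_elim (use abs_partial_sum_product_le in simp)
  qed measurable
  then show ?thesis by (simp only: integral_partial_sum_product)
qed

lemma cov_term_sums: "(\<lambda>j. cov_term j) sums (\<chi> a c. \<integral>\<omega>. noise_series (w_path \<omega>) $ a * noise_series (w_path \<omega>) $ c \<partial>M)"
  unfolding sums_def
proof (intro vec_tendstoI)
  fix a c
  show "(\<lambda>n. (\<Sum>j<n. cov_term j) $ a $ c) \<longlonglongrightarrow> (\<chi> a c. \<integral>\<omega>. noise_series (w_path \<omega>) $ a * noise_series (w_path \<omega>) $ c \<partial>M) $ a $ c"
    using partial_cov_tendsto[of a c] by simp
qed

lemma integrable_series_term: "integrable M (series_term j)"
  unfolding series_term_eq[abs_def] by (rule integrable_bounded_linear[OF matrix_vector_mul_bounded_linear integrable_centered_W])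

lemma integral_series_term: "(\<integral>\<omega>. series_term j \<omega> \<partial>M) = 0"
  unfolding series_term_eq[abs_def] integral_bounded_linear[OF matrix_vector_mul_bounded_linear integrable_centered_W] integral_centered_W by simp

lemma noise_series_w_path_integral: "integrable M (\<lambda>\<omega>. noise_series (w_path \<omega>))" "(\<integral>\<omega>. noise_series (w_path \<omega>) \<partial>M) = 0"
proof -
  define K1 where "K1 = (\<integral>\<omega>. norm (W 0 \<omega> - w_mean) \<partial>M)"
  have K1j: "(\<integral>\<omega>. norm (W j \<omega> - w_mean) \<partial>M) = K1" for j
    unfolding K1_def by (rule integral_W_eq[of "\<lambda>x. norm (x - w_mean)"]) measurable
  have a1: "AE \<omega> in M. summable (\<lambda>i. norm (series_term i \<omega>))"
    using AE_summable_w_path by (rule AE_mp) (auto intro!: AE_I2 dest: summable_norm_series_term simp: w_path_def series_term_def)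
  have a2: "summable (\<lambda>i. \<integral>\<omega>. norm (series_term i \<omega>) \<partial>M)"
  proof (rule summable_comparison_test'[where N=0])
    show "summable (\<lambda>i. gain i * K1)"
      using gain_shift_sums[of 0] by (intro summable_mult2) (simp add: sums_iff)
    show "norm (\<integral>\<omega>. norm (series_term i \<omega>) \<partial>M) \<le> gain i * K1" for i
    proof -
      have "(\<integral>\<omega>. norm (series_term i \<omega>) \<partial>M) \<le> (\<integral>\<omega>. gain i * norm (W i \<omega> - w_mean) \<partial>M)"
        by (intro integral_mono integrable_norm integrable_series_term integrable_mult_right integrable_centered_W)
          (simp add: series_term_def norm_series_term_le)
      also have "\<dots> = gain i * K1" by (simp add: K1j)
      finally show ?thesis by simp
    qed
  qed
  have "integrable M (\<lambda>\<omega>. \<Sum>i. series_term i \<omega>)"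
    by (rule integrable_suminf[OF integrable_series_term a1 a2])
  then show "integrable M (\<lambda>\<omega>. noise_series (w_path \<omega>))" by (simp add: noise_series_w_path)
  have "(\<integral>\<omega>. (\<Sum>i. series_term i \<omega>) \<partial>M) = (\<Sum>i. \<integral>\<omega>. series_term i \<omega> \<partial>M)"
    by (rule integral_suminf[OF integrable_series_term a1 a2])
  then show "(\<integral>\<omega>. noise_series (w_path \<omega>) \<partial>M) = 0" by (simp add: noise_series_w_path integral_series_term)
qed

lemma integrable_power2_noise_series: "integrable M (\<lambda>\<omega>. (norm (noise_series (w_path \<omega>)))\<^sup>2)"
proof (rule Bochner_Integration.integrable_bound[OF integrable_series_majorant])
  show "AE \<omega> in M. norm ((norm (noise_series (w_path \<omega>)))\<^sup>2) \<le> norm (series_majorant \<omega>)"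
    using AE_summable_w_path
  proof eventually_elim
    case (elim \<omega>)
    have "norm (noise_series (w_path \<omega>)) \<le> tail_sum 0 (w_path \<omega>)"
      using norm_noise_series_tail_le[OF elim, of 0] by simp
    then have "(norm (noise_series (w_path \<omega>)))\<^sup>2 \<le> (tail_sum 0 (w_path \<omega>))\<^sup>2"
      by (intro power_mono) simp_all
    then show ?case by (simp add: series_majorant_def tail_sum_def w_path_def)
  qed
qed measurable

lemma integrable_power2_limit_state: "integrable M (\<lambda>\<omega>. (norm (limit_state (w_path \<omega>)))\<^sup>2)"
  unfolding limit_state_def
  by (rule integrable_power2_norm_add) (simp_all add: integrable_power2_noise_series)

lemma mean_limit_law: "mean_law (distr M borel (\<lambda>\<omega>. limit_state (w_path \<omega>))) = equilibrium"
proof -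
  have "mean_law (distr M borel (\<lambda>\<omega>. limit_state (w_path \<omega>))) = (\<integral>\<omega>. equilibrium + noise_series (w_path \<omega>) \<partial>M)"
    unfolding mean_law_def limit_state_def by (simp add: integral_distr)
  also have "\<dots> = equilibrium"
    using noise_series_w_path_integral by (simp add: prob_space)
  finally show ?thesis .
qed

lemma cov_limit_law: "cov_term sums cov_law (distr M borel (\<lambda>\<omega>. limit_state (w_path \<omega>)))"
proof -
  have "cov_law (distr M borel (\<lambda>\<omega>. limit_state (w_path \<omega>)))
      = (\<chi> a c. \<integral>\<omega>. noise_series (w_path \<omega>) $ a * noise_series (w_path \<omega>) $ c \<partial>M)"
    unfolding cov_law_def mean_limit_law by (simp add: integral_distr limit_state_def)
  then show ?thesis using cov_term_sums by simp
qed

lemma limit_law_square_integrable: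
  assumes "prob_space N" "Xb \<in> borel_measurable N"
    and "distr N borel Xb = distr M borel (\<lambda>\<omega>. limit_state (w_path \<omega>))"
  shows "integrable N (\<lambda>\<omega>. (norm (Xb \<omega>))\<^sup>2)"
proof -
  have "integrable (distr N borel Xb) (\<lambda>x. (norm x)\<^sup>2)"
    unfolding assms(3) by (subst integrable_distr_eq) (simp_all add: integrable_power2_limit_state)
  with assms(2) show ?thesis by (subst (asm) integrable_distr_eq) simp_all
qed

lemma limit_law_step_invariant:
  fixes N :: "'b measure" and Xb :: "'b \<Rightarrow> real^'nx"
  assumes "prob_space N" and [measurable]: "Xb \<in> borel_measurable N"
    and law: "distr N borel Xb = distr M borel (\<lambda>\<omega>. limit_state (w_path \<omega>))"
  shows "distr N borel Xb = distr (N \<Otimes>\<^sub>M w_law) borel (\<lambda>(\<omega>, w). At *v Xb \<omega> + Ft *v w_mean + E *v (w - w_mean))"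
proof -
  define step where "step = (\<lambda>(x, w). At *v x + Ft *v w_mean + E *v (w - w_mean))"
  have law': "distr N borel Xb = distr path_law borel limit_state"
    using law distr_limit_state_w_path[of "\<lambda>x. x"] by simp
  have sets_pair: "sets (path_law \<Otimes>\<^sub>M w_law) = sets (borel_paths \<Otimes>\<^sub>M borel)"
    by (rule sets_pair_measure_cong) (simp_all add: sets_path_law)
  have [measurable]: "step \<in> borel_measurable (borel \<Otimes>\<^sub>M w_law)"
    unfolding step_def by (simp add: measurable_cong_sets[OF sets_pair_measure_cong[OF refl sets_w_law] refl])
  have distr_fst: "distr (path_law \<Otimes>\<^sub>M w_law) path_law fst = path_law"
    by (rule prob_space.distr_pair_fst[OF prob_space_w_law])
  have "AE p in path_law \<Otimes>\<^sub>M w_law. summable_path (fst p)"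
    by (rule AE_distrD[OF measurable_fst]) (unfold distr_fst, rule AE_summable_path)
  then have "distr (path_law \<Otimes>\<^sub>M w_law) borel (\<lambda>p. step (limit_state (fst p), snd p))
      = distr (path_law \<Otimes>\<^sub>M w_law) borel (\<lambda>p. limit_state (case_nat (snd p) (fst p)))"
    by (intro distr_cong_AE)
      (auto elim!: AE_mp simp: step_def limit_state_shift measurable_cong_sets[OF sets_pair refl])
  also have "\<dots> = distr path_law borel limit_state"
    using measurable_path_shift
    by (subst (2) distr_path_law_shift[symmetric], subst distr_distr) (simp_all add: comp_def case_prod_beta)
  also have "distr (N \<Otimes>\<^sub>M w_law) borel (\<lambda>p. step (Xb (fst p), snd p))
      = distr (path_law \<Otimes>\<^sub>M w_law) borel (\<lambda>p. step (limit_state (fst p), snd p))"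
    using assms(1) prob_space_path_law prob_space_w_law law'
    by (intro distr_pair_measure_eq_if_distr_eq) (simp_all add: prob_space_imp_sigma_finite)
  ultimately show ?thesis
    using law' by (simp add: step_def case_prod_beta')
qed

lemma limit_law_stationary_pair:
  fixes N :: "'b measure" and Xb :: "'b \<Rightarrow> real^'nx"
  assumes "At = A + B ** K" "Ft = B ** F + E"
    and "prob_space N" "Xb \<in> borel_measurable N"
    and "distr N borel Xb = distr M borel (\<lambda>\<omega>. limit_state (w_path \<omega>))"
  shows "stationary_pair A B E w_law N Xb (\<lambda>\<omega>. K *v Xb \<omega> + F *v w_mean)"
  by (rule stationary_pair_feedbackI[OF assms(3,4) limit_law_square_integrable[OF assms(3-5)]])
    (simp add: closed_loop_eq[OF assms(1,2)] limit_law_step_invariant[OF assms(3-5)])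

end

theorem lemma4:
  fixes A :: "real^'nx^'nx" and B :: "real^'nu^'nx" and E :: "real^'nw^'nx"
    and Q :: "real^'nx^'nx" and R :: "real^'nu^'nu"
    and P :: "real^'nx^'nx" and K :: "real^'nx^'nu" and At :: "real^'nx^'nx"
    and G :: "real^'nw^'nx" and F :: "real^'nw^'nu" and Ft :: "real^'nw^'nx"
    and M :: "'a measure" and Xini :: "'a \<Rightarrow> real^'nx" and W :: "nat \<Rightarrow> 'a \<Rightarrow> real^'nw"
    and Xd :: "nat \<Rightarrow> 'a \<Rightarrow> real^'nx" and Ud :: "nat \<Rightarrow> 'a \<Rightarrow> real^'nu"
    and Xs :: "'a \<Rightarrow> real^'nx" and Us :: "'a \<Rightarrow> real^'nu"
  assumes Q_psd: "psd Q" and R_pd: "pd R"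
    and stab: "stabilizable A B" and detect: "detectable A (msqrt Q)"
    \<comment> \<open>P: the stabilizing symmetric PSD solution of the DARE\<close>
    and P_psd: "psd P"
    and P_dare: "P = Q + transpose A ** (P - P ** B ** matrix_inv (R + transpose B ** P ** B) ** transpose B ** P) ** A"
    and K_def: "K = - (matrix_inv (R + transpose B ** P ** B) ** transpose B ** P ** A)"
    and At_def: "At = A + B ** K"
    and P_stabilizing: "schur_stable At"
    and G_eq: "G = transpose At ** (P ** E + G)"
    and F_def: "F = - (matrix_inv (R + transpose B ** P ** B) ** transpose B ** (P ** E + G))"
    and Ft_def: "Ft = B ** F + E"
    \<comment> \<open>probabilistic setting\<close>
    and M: "prob_space M"
    and Xini_meas: "Xini \<in> borel_measurable M"
    and Xini_L2: "integrable M (\<lambda>\<omega>. (norm (Xini \<omega>))\<^sup>2)"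
    and W_meas: "\<And>k. W k \<in> borel_measurable M"
    and W_L2: "\<And>k. integrable M (\<lambda>\<omega>. (norm (W k \<omega>))\<^sup>2)"
    and W_ident: "\<And>k. distr M borel (W k) = distr M borel (W 0)"
    and W_indep: "prob_space.indep_vars M (\<lambda>_. borel) W UNIV"
    and Xini_indep: "prob_space.indep_set M {Xini -` S \<inter> space M | S. S \<in> sets borel}
        {(\<lambda>\<omega> k. W k \<omega>) -` S \<inter> space M | S. S \<in> sets (PiM UNIV (\<lambda>_. borel))}"
    \<comment> \<open>the overtakingly optimal trajectory\<close>
    and Xd_0: "Xd 0 = Xini"
    and Ud_def: "\<And>k \<omega>. Ud k \<omega> = K *v Xd k \<omega> + F *v (\<integral>\<omega>'. W 0 \<omega>' \<partial>M)"
    and Xd_Suc: "\<And>k \<omega>. Xd (Suc k) \<omega> = A *v Xd k \<omega> + B *v Ud k \<omega> + E *v W k \<omega>"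
    \<comment> \<open>the limit random variables\<close>
    and Xs_def: "\<And>\<omega>. Xs \<omega> = matrix_inv (mat 1 - At) ** Ft *v (\<integral>\<omega>'. W 0 \<omega>' \<partial>M)
        + (\<Sum>j. matpow At j *v (E *v (W j \<omega> - (\<integral>\<omega>'. W 0 \<omega>' \<partial>M))))"
    and Us_def: "\<And>\<omega>. Us \<omega> = (K ** matrix_inv (mat 1 - At) ** Ft + F) *v (\<integral>\<omega>'. W 0 \<omega>' \<partial>M)
        + K *v (\<Sum>j. matpow At j *v (E *v (W j \<omega> - (\<integral>\<omega>'. W 0 \<omega>' \<partial>M))))"
  shows "weak_conv_law (\<lambda>k. distr M borel (Xd k)) (distr M borel Xs)
       \<and> weak_conv_law (\<lambda>k. distr M borel (Ud k)) (distr M borel Us)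
       \<and> W2_conv_law (\<lambda>k. distr M borel (Xd k)) (distr M borel Xs)
       \<and> W2_conv_law (\<lambda>k. distr M borel (Ud k)) (distr M borel Us)
       \<and> mean_law (distr M borel Xs) = matrix_inv (mat 1 - At) ** Ft *v (\<integral>\<omega>'. W 0 \<omega>' \<partial>M)
       \<and> summable (\<lambda>j. matpow At j ** E ** cov_law (distr M borel (W 0)) ** transpose E ** transpose (matpow At j))
       \<and> cov_law (distr M borel Xs) =
           (\<Sum>j. matpow At j ** E ** cov_law (distr M borel (W 0)) ** transpose E ** transpose (matpow At j))
       \<and> (\<forall>(N :: 'b measure) (Xb :: 'b \<Rightarrow> real^'nx).
            prob_space N \<and> Xb \<in> borel_measurable N \<and> distr N borel Xb = distr M borel Xs \<longrightarrow>
            stationary_pair A B E (distr M borel (W 0)) N Xb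
              (\<lambda>\<omega>. K *v Xb \<omega> + F *v (\<integral>\<omega>'. W 0 \<omega>' \<partial>M)))"
proof -
  interpret prob_space M by (rule M)
  obtain C r where "0 < r" "r < 1" "0 \<le> C" "\<And>k x. norm (matpow At k *v x) \<le> C * r^k * norm x"
    by (rule schur_stable_matpow_bound[OF P_stabilizing]) iprover
  then interpret L: stable_noise_filter M W At E Ft C r
    using W_meas W_L2 W_ident W_indep by unfold_locales auto
  define m where "m = (\<integral>\<omega>'. W 0 \<omega>' \<partial>M)"
  have m: "L.w_mean = m" by (simp add: L.w_mean_def m_def)
  have Xs: "Xs = (\<lambda>\<omega>. L.limit_state (L.w_path \<omega>))"
    by (simp add: fun_eq_iff Xs_def L.limit_state_def L.equilibrium_def L.noise_series_def L.w_path_def m m_def)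
  have Us: "Us = (\<lambda>\<omega>. K *v Xs \<omega> + F *v m)"
    by (simp add: fun_eq_iff Us_def Xs_def m_def matrix_vector_mult_add_rdistrib
        matrix_vector_right_distrib matrix_vector_mul_assoc[symmetric] algebra_simps)
  have laws: "weak_conv_law (\<lambda>k. distr M borel (\<lambda>\<omega>. g (Xd k \<omega>))) (distr M borel (\<lambda>\<omega>. g (Xs \<omega>)))
      \<and> W2_conv_law (\<lambda>k. distr M borel (\<lambda>\<omega>. g (Xd k \<omega>))) (distr M borel (\<lambda>\<omega>. g (Xs \<omega>)))"
    if "L'-lipschitz_on UNIV g" for g :: "real^'nx \<Rightarrow> 'c::euclidean_space" and L'
    unfolding Xs using Xini_L2 Xini_indep
    by (intro L.closed_loop_laws_converge[OF _ _ _ _ that]) (simp_all add: Xd_0 Xini_meas Xd_Suc Ud_def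
        closed_loop_eq[OF At_def Ft_def] m L.w_path_def[abs_def] flip: m_def)
  show ?thesis
    using laws[OF lipschitz_on_id] laws[OF lipschitz_on_matrix_affine, of K "F *v m"]
      L.mean_limit_law L.cov_limit_law L.limit_law_stationary_pair[OF At_def Ft_def]
    by (simp add: Us Ud_def[abs_def] sums_iff L.cov_term_def[abs_def] L.w_law_def L.equilibrium_def m m_def
        flip: Xs m_def) blast
qed

end
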